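(* Let $\Omega \subset \mathbb{R}^2$ be a convex body, $M > 0$, and let $g : \mathbb{R}^2 \to \mathbb{R}$ be a function of class $C^2$ such that the matrix of second derivatives $D^2 g$ has at least one negative eigenvalue for all values of the argument. Consider the problem of minimizing $$\mathcal{F}[u] = \iint_\Omega g(\nabla u(x_1,x_2))\, dx_1\, dx_2$$ in the class of concave functions $u : \Omega \to \mathbb{R}$ satisfying $0 \le u(x) \le M$ for all $x = (x_1,x_2) \in \Omega$. Assume that $u$ is a solution of this problem and that there is an open set $\mathcal{U} \subset \Omega$ such that (a) $u \in C^2(\mathcal{U})$, (b) $u(x) < M$ for all $x \in \mathcal{U}$. Then $\det D^2 u(x) = 0$ for all $x \in \mathcal{U}$.
   Context: A convex body in $\mathbb{R}^2$ is a compact convex set with nonempty interior. $D^2 u(x)$ and $D^2 g$ denote the $2\times 2$ matrices of second partial derivatives. $\mathcal{U}$ is open as a subset of $\mathbb{R}^2$. A concave function is differentiable almost everywhere in the interior of $\Omega$. A solution is a function $u$ in the stated class (with $g(\nabla u)$ integrable over $\Omega$) such that $\mathcal{F}[u] \le \mathcal{F}[v]$ for every $v$ in the class for which $g(\nabla v)$ is integrable. *)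

theory Defs
  imports "HOL-Analysis.Analysis"
begin

definition convex_body :: "(real ^ 2) set \<Rightarrow> bool" where
  "convex_body K \<longleftrightarrow> compact K \<and> convex K \<and> interior K \<noteq> {}"

definition partially_differentiable ::
    "'n \<Rightarrow> (real ^ 'n::finite \<Rightarrow> real) \<Rightarrow> real ^ 'n \<Rightarrow> bool" where
  "partially_differentiable i f x \<longleftrightarrow>
     (\<lambda>t. f (x + t *\<^sub>R axis i 1)) field_differentiable (at 0)"

definition partial_deriv ::
    "'n \<Rightarrow> (real ^ 'n::finite \<Rightarrow> real) \<Rightarrow> real ^ 'n \<Rightarrow> real" where
  "partial_deriv i f x = deriv (\<lambda>t. f (x + t *\<^sub>R axis i 1)) 0"

(* Where a partial derivative fails to exist, the corresponding component is unspecified.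
   For a concave function on a convex body this concerns only a Lebesgue null set
   (which includes the boundary of the body). *)
definition gradient :: "(real ^ 'n::finite \<Rightarrow> real) \<Rightarrow> real ^ 'n \<Rightarrow> real ^ 'n" where
  "gradient f x = (\<chi> i. partial_deriv i f x)"

definition hessian :: "(real ^ 'n::finite \<Rightarrow> real) \<Rightarrow> real ^ 'n \<Rightarrow> real ^ 'n ^ 'n" where
  "hessian f x = (\<chi> i j. partial_deriv i (partial_deriv j f) x)"

(* Intended for open U. Continuity of f itself on U then follows. *)
definition C1_on :: "(real ^ 'n::finite \<Rightarrow> real) \<Rightarrow> (real ^ 'n) set \<Rightarrow> bool" where
  "C1_on f U \<longleftrightarrow>
     (\<forall>i. (\<forall>x\<in>U. partially_differentiable i f x) \<and> continuous_on U (partial_deriv i f))"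

definition C2_on :: "(real ^ 'n::finite \<Rightarrow> real) \<Rightarrow> (real ^ 'n) set \<Rightarrow> bool" where
  "C2_on f U \<longleftrightarrow> C1_on f U \<and> (\<forall>i. C1_on (partial_deriv i f) U)"

definition is_eigenvalue :: "real ^ 'n ^ 'n::finite \<Rightarrow> real \<Rightarrow> bool" where
  "is_eigenvalue A l \<longleftrightarrow> (\<exists>v. v \<noteq> 0 \<and> A *v v = l *s v)"

definition admissible :: "(real ^ 2) set \<Rightarrow> real \<Rightarrow> (real ^ 2 \<Rightarrow> real) \<Rightarrow> bool" where
  "admissible \<Omega> M u \<longleftrightarrow> concave_on \<Omega> u \<and> (\<forall>x\<in>\<Omega>. 0 \<le> u x \<and> u x \<le> M)"

(* Integrability and integral are taken with respect to the completed measure lebesgue: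
   the gradient is unspecified on a null set that need not be Borel, so that lborel
   would impose a spurious measurability condition there. *)
definition has_finite_energy ::
    "(real ^ 2) set \<Rightarrow> (real ^ 2 \<Rightarrow> real) \<Rightarrow> (real ^ 2 \<Rightarrow> real) \<Rightarrow> bool" where
  "has_finite_energy \<Omega> g u \<longleftrightarrow> set_integrable lebesgue \<Omega> (\<lambda>x. g (gradient u x))"

definition energy :: "(real ^ 2) set \<Rightarrow> (real ^ 2 \<Rightarrow> real) \<Rightarrow> (real ^ 2 \<Rightarrow> real) \<Rightarrow> real" where
  "energy \<Omega> g u = set_lebesgue_integral lebesgue \<Omega> (\<lambda>x. g (gradient u x))"

definition is_solution ::
    "(real ^ 2) set \<Rightarrow> real \<Rightarrow> (real ^ 2 \<Rightarrow> real) \<Rightarrow> (real ^ 2 \<Rightarrow> real) \<Rightarrow> bool" where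
  "is_solution \<Omega> M g u \<longleftrightarrow>
     admissible \<Omega> M u \<and> has_finite_energy \<Omega> g u \<and>
     (\<forall>v. admissible \<Omega> M v \<and> has_finite_energy \<Omega> g v \<longrightarrow> energy \<Omega> g u \<le> energy \<Omega> g v)"

end

theory Submission
  imports Defs
begin

text \<open>
  Suppose the Hessian of \<open>u\<close> is nondegenerate at \<open>x\<^sub>0\<close>. Being symmetric and nonpositive, it is
  negative definite, so \<open>u\<close> is uniformly strongly concave near \<open>x\<^sub>0\<close> and stays away from \<open>0\<close> and
  \<open>M\<close>. Hence \<open>u + t \<phi>\<close> is a competitor for every \<open>\<phi>\<close> with Lipschitz gradient supported near
  \<open>x\<^sub>0\<close> and every small \<open>t\<close> of either sign, and the second variation at \<open>u\<close> must be nonnegative.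
  It is violated by oscillating perturbations \<open>\<phi> = \<eta> cos(k \<bullet> x + \<theta>)\<close> with bump \<open>\<eta>\<close> and \<open>k\<close> a large
  multiple of an eigenvector of the Hessian of \<open>g\<close> at the gradient of \<open>u\<close> in \<open>x\<^sub>0\<close> with negative
  eigenvalue. For a quadratic form \<open>Q\<close>, the contributions of the phases \<open>\<theta> = 0\<close> and
  \<open>\<theta> = \<pi>/2\<close> add up pointwise to \<open>\<eta>\<^sup>2 Q(k) + Q(\<nabla>\<eta>)\<close>, in which the oscillation has cancelled; adding
  the opposite phases \<open>\<theta> + \<pi>\<close> removes the first variation.
\<close>

subsection \<open>Functions with continuous partial derivatives\<close>

lemma has_derivative_imp_partial:
  fixes f :: "real ^ 'n::finite \<Rightarrow> real"
  assumes "(f has_derivative (\<lambda>h. G \<bullet> h)) (at x)"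
  shows "((\<lambda>t. f (x + t *\<^sub>R axis i 1)) has_field_derivative G $ i) (at 0)"
proof -
  have *: "((\<lambda>t. x + t *\<^sub>R axis i 1) has_derivative (\<lambda>t. t *\<^sub>R axis i 1)) (at 0)"
    by (auto intro!: derivative_eq_intros)
  have "((\<lambda>t. f (x + t *\<^sub>R axis i 1)) has_derivative (\<lambda>t. G \<bullet> (t *\<^sub>R axis i 1))) (at 0)"
    by (rule has_derivative_compose[OF *]) (use assms in simp)
  then show ?thesis
    by (simp add: has_field_derivative_def inner_axis mult_commute_abs)
qed

lemma gradient_eqI:
  fixes f :: "real ^ 'n::finite \<Rightarrow> real"
  assumes "(f has_derivative (\<lambda>h. G \<bullet> h)) (at x)"
  shows "gradient f x = G"
  by (simp add: gradient_def partial_deriv_def vec_eq_iff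
      DERIV_imp_deriv[OF has_derivative_imp_partial[OF assms]])

text \<open>This covers points where partial derivatives fail to exist: \<open>deriv\<close> then
  has the same unspecified value for both functions.\<close>

lemma gradient_cong_ev:
  fixes f g :: "real ^ 'n::finite \<Rightarrow> real"
  assumes "eventually (\<lambda>y. f y = g y) (nhds x)"
  shows "gradient f x = gradient g x"
proof -
  have "eventually (\<lambda>t. f (x + t *\<^sub>R axis i 1) = g (x + t *\<^sub>R axis i 1)) (nhds 0)" for i
  proof -
    have "((\<lambda>t::real. x + t *\<^sub>R axis i 1) \<longlongrightarrow> x + 0 *\<^sub>R axis i 1) (nhds 0)"
      by (intro tendsto_intros filterlim_ident)
    then show ?thesis
      using assms eventually_compose_filterlim[of _ "nhds x"] by fastforce
  qed
  then show ?thesis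
    by (auto simp: gradient_def partial_deriv_def vec_eq_iff intro!: deriv_cong_ev)
qed

lemma partially_differentiable_DERIV:
  fixes f :: "real ^ 'n::finite \<Rightarrow> real"
  assumes "partially_differentiable i f (x + s *\<^sub>R axis i 1)"
  shows "((\<lambda>t. f (x + t *\<^sub>R axis i 1)) has_real_derivative
           partial_deriv i f (x + s *\<^sub>R axis i 1)) (at s)"
proof -
  have "((\<lambda>t. f (x + s *\<^sub>R axis i 1 + t *\<^sub>R axis i 1)) has_real_derivative
           partial_deriv i f (x + s *\<^sub>R axis i 1)) (at 0)"
    using assms unfolding partially_differentiable_def partial_deriv_def
    by (simp add: DERIV_deriv_iff_field_differentiable)
  then have "((\<lambda>t. f (x + (t + s) *\<^sub>R axis i 1)) has_real_derivative
           partial_deriv i f (x + s *\<^sub>R axis i 1)) (at 0)"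
    by (simp add: algebra_simps)
  then show ?thesis
    using DERIV_shift[of "\<lambda>t. f (x + t *\<^sub>R axis i 1)" _ 0 s] by simp
qed

lemma partial_mvt:
  fixes f :: "real ^ 'n::finite \<Rightarrow> real"
  assumes "\<And>s. \<bar>s\<bar> \<le> \<bar>t\<bar> \<Longrightarrow> partially_differentiable i f (x + s *\<^sub>R axis i 1)"
  shows "\<exists>s. \<bar>s\<bar> \<le> \<bar>t\<bar> \<and> f (x + t *\<^sub>R axis i 1) - f x = t * partial_deriv i f (x + s *\<^sub>R axis i 1)"
proof -
  let ?F = "\<lambda>s. f (x + s *\<^sub>R axis i 1)"
  let ?D = "\<lambda>s. partial_deriv i f (x + s *\<^sub>R axis i 1)"
  have D: "(?F has_real_derivative ?D s) (at s)" if "\<bar>s\<bar> \<le> \<bar>t\<bar>" for s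
    using partially_differentiable_DERIV assms that by blast
  consider "t = 0" | "t > 0" | "t < 0" by linarith
  then show ?thesis
  proof cases
    case 2
    from MVT2[of 0 t ?F ?D] D 2 obtain z where "0 < z" "z < t" "?F t - ?F 0 = (t - 0) * ?D z"
      by auto
    then show ?thesis by (intro exI[of _ z]) auto
  next
    case 3
    from MVT2[of t 0 ?F ?D] D 3 obtain z where "t < z" "z < 0" "?F 0 - ?F t = (0 - t) * ?D z"
      by auto
    then show ?thesis by (intro exI[of _ z]) auto
  qed auto
qed

text \<open>\<open>C1_on\<close> speaks of partial derivatives only. The increment from
  \<open>x\<close> to \<open>y\<close> is split into two axis-parallel steps; the mean value theorem
  turns each into a partial derivative at a nearby point, and continuity controls the error.\<close>

lemma C1_on_has_derivative:
  fixes f :: "real ^ 2 \<Rightarrow> real"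
  assumes "C1_on f U" "open U" "x \<in> U"
  shows "(f has_derivative (\<lambda>h. gradient f x \<bullet> h)) (at x)"
  unfolding has_derivative_iff_norm
proof (intro conjI bounded_linear_inner_right)
  show "((\<lambda>y. norm (f y - f x - gradient f x \<bullet> (y - x)) / norm (y - x)) \<longlongrightarrow> 0) (at x)"
  proof (rule tendstoI)
    fix e :: real assume "e > 0"
    have "\<exists>d>0. \<forall>y. dist y x < d \<longrightarrow> \<bar>partial_deriv i f y - partial_deriv i f x\<bar> < e / 2" for i
    proof -
      have "continuous (at x) (partial_deriv i f)"
        using assms continuous_on_eq_continuous_at unfolding C1_on_def by blast
      then show ?thesis
        unfolding continuous_at_eps_delta using \<open>e > 0\<close> by (metis dist_real_def half_gt_zero)
    qed
    then obtain d where d: "\<And>i. d i > 0"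
      "\<And>i y. dist y x < d i \<Longrightarrow> \<bar>partial_deriv i f y - partial_deriv i f x\<bar> < e / 2"
      by metis
    obtain r where r: "r > 0" "ball x r \<subseteq> U"
      using assms open_contains_ball by blast
    define D where "D = min r (min (d 1) (d 2))"
    have "D > 0" using r d by (simp add: D_def)
    have "dist (norm (f y - f x - gradient f x \<bullet> (y - x)) / norm (y - x)) 0 < e"
      if y: "y \<noteq> x" "dist y x < D" for y
    proof -
      define h where "h = y - x"
      have h: "norm h < D" "h \<noteq> 0" using y by (auto simp: h_def dist_norm)
      have y_eq: "y = x + h $ 1 *\<^sub>R axis 1 1 + h $ 2 *\<^sub>R axis 2 1"
        by (simp add: h_def vec_eq_iff forall_2 axis_def)
      have near: "dist (x + a *\<^sub>R axis 1 1 + b *\<^sub>R axis 2 1) x < D"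
        if "\<bar>a\<bar> \<le> \<bar>h $ 1\<bar>" "\<bar>b\<bar> \<le> \<bar>h $ 2\<bar>" for a b
      proof -
        have "norm (a *\<^sub>R axis 1 1 + b *\<^sub>R axis 2 1 :: real ^ 2) \<le> norm h"
          by (rule norm_le_componentwise_cart) (use that in \<open>auto simp: forall_2 axis_def\<close>)
        then show ?thesis using h by (simp add: dist_norm add.assoc)
      qed
      have pd: "partially_differentiable i f z" if "dist z x < D" for i z
        using assms(1) r that unfolding C1_on_def D_def
        by (metis dist_commute mem_ball min_less_iff_conj subsetD)
      obtain s where s: "\<bar>s\<bar> \<le> \<bar>h $ 1\<bar>"
        "f (x + h $ 1 *\<^sub>R axis 1 1) - f x = h $ 1 * partial_deriv 1 f (x + s *\<^sub>R axis 1 1)"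
        using partial_mvt[of "h $ 1" 1 f x] pd near[of _ 0] by auto
      obtain t where t: "\<bar>t\<bar> \<le> \<bar>h $ 2\<bar>"
        "f y - f (x + h $ 1 *\<^sub>R axis 1 1)
           = h $ 2 * partial_deriv 2 f (x + h $ 1 *\<^sub>R axis 1 1 + t *\<^sub>R axis 2 1)"
        using partial_mvt[of "h $ 2" 2 f "x + h $ 1 *\<^sub>R axis 1 1"] pd near[of "h $ 1"]
        unfolding y_eq[symmetric] by auto
      define A where "A = partial_deriv 1 f (x + s *\<^sub>R axis 1 1) - partial_deriv 1 f x"
      define B where "B = partial_deriv 2 f (x + h $ 1 *\<^sub>R axis 1 1 + t *\<^sub>R axis 2 1)
        - partial_deriv 2 f x"
      have AB: "\<bar>A\<bar> < e / 2" "\<bar>B\<bar> < e / 2"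
        unfolding A_def B_def using near[of s 0] near[of "h $ 1" t] s(1) t(1)
        by (simp_all add: D_def d(2) del: less_divide_eq_numeral1)
      have "f y - f x - gradient f x \<bullet> h = h $ 1 * A + h $ 2 * B"
        using s(2) t(2) by (simp add: A_def B_def gradient_def inner_vec_def sum_2 algebra_simps)
      also have "\<bar>\<dots>\<bar> \<le> \<bar>h $ 1\<bar> * \<bar>A\<bar> + \<bar>h $ 2\<bar> * \<bar>B\<bar>"
        by (metis abs_mult abs_triangle_ineq)
      also have "\<dots> \<le> norm h * \<bar>A\<bar> + norm h * \<bar>B\<bar>"
        by (intro add_mono mult_right_mono component_le_norm_cart abs_ge_zero)
      also have "\<dots> < norm h * e"
        using AB h by (simp flip: distrib_left)
      finally show ?thesis
        using h by (simp add: h_def[symmetric] divide_simps mult.commute abs_mult)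
    qed
    then show "\<forall>\<^sub>F y in at x. dist (norm (f y - f x - gradient f x \<bullet> (y - x)) / norm (y - x)) 0 < e"
      using \<open>D > 0\<close> by (auto simp: eventually_at)
  qed
qed

text \<open>Two nested mean value theorems: along axis \<open>i\<close> for the difference
  \<open>F\<close> of two translates of \<open>f\<close>, then along axis \<open>j\<close>. The
  second difference is symmetric in \<open>i\<close> and \<open>j\<close>, which forces the mixed
  derivatives to agree.\<close>

lemma double_difference_mvt:
  fixes f :: "real ^ 'n::finite \<Rightarrow> real"
  assumes f: "C2_on f (ball x r)" and h: "0 < h" "2 * h < r"
  shows "\<exists>y\<in>ball x r. f (x + h *\<^sub>R axis i 1 + h *\<^sub>R axis j 1) - f (x + h *\<^sub>R axis i 1)
    - f (x + h *\<^sub>R axis j 1) + f x = h * h * partial_deriv j (partial_deriv i f) y"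
proof -
  have near: "x + a *\<^sub>R axis i 1 + b *\<^sub>R axis j 1 \<in> ball x r" if "\<bar>a\<bar> \<le> h" "\<bar>b\<bar> \<le> h" for a b
  proof -
    have "norm (a *\<^sub>R axis i 1 + b *\<^sub>R axis j 1 :: real ^ 'n) \<le> \<bar>a\<bar> + \<bar>b\<bar>"
      by (rule order.trans[OF norm_triangle_ineq]) (simp add: norm_axis_1)
    also have "\<dots> < r" using that h by linarith
    finally show ?thesis
      by (metis add.assoc add_diff_cancel_left' dist_commute dist_norm mem_ball)
  qed
  define F where "F s = f (x + h *\<^sub>R axis j 1 + s *\<^sub>R axis i 1) - f (x + s *\<^sub>R axis i 1)" for s
  define F' where "F' s = partial_deriv i f (x + h *\<^sub>R axis j 1 + s *\<^sub>R axis i 1)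
     - partial_deriv i f (x + s *\<^sub>R axis i 1)" for s
  have "(F has_real_derivative F' s) (at s)" if "0 \<le> s" "s \<le> h" for s
    unfolding F_def F'_def
    by (intro derivative_intros partially_differentiable_DERIV)
       (use f near[of s h] near[of s 0] that h in \<open>auto simp: C2_on_def C1_on_def add_ac\<close>)
  then obtain s where s: "0 < s" "s < h" "F h - F 0 = (h - 0) * F' s"
    using MVT2[of 0 h F F'] h by blast
  obtain t where t: "\<bar>t\<bar> \<le> \<bar>h\<bar>"
    "partial_deriv i f (x + s *\<^sub>R axis i 1 + h *\<^sub>R axis j 1) - partial_deriv i f (x + s *\<^sub>R axis i 1)
      = h * partial_deriv j (partial_deriv i f) (x + s *\<^sub>R axis i 1 + t *\<^sub>R axis j 1)"
    using partial_mvt[of h j "partial_deriv i f" "x + s *\<^sub>R axis i 1"] f near[of s] s h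
    by (force simp: C2_on_def C1_on_def)
  have "F h - F 0 = h * (h * partial_deriv j (partial_deriv i f) (x + s *\<^sub>R axis i 1 + t *\<^sub>R axis j 1))"
    using s(3) t(2) by (simp add: F'_def add_ac)
  then show ?thesis
    using near[of s t] s t h unfolding F_def
    by (intro bexI[of _ "x + s *\<^sub>R axis i 1 + t *\<^sub>R axis j 1"]) (auto simp: algebra_simps)
qed

lemma C2_on_subset: "C2_on f U \<Longrightarrow> V \<subseteq> U \<Longrightarrow> C2_on f V"
  unfolding C2_on_def C1_on_def by (meson continuous_on_subset subsetD)

text \<open>Schwarz's theorem: one and the same second difference yields a value of either mixed
  derivative. If these differed at \<open>x\<close>, continuity would keep their values apart on a
  small ball.\<close>

lemma C2_on_partial_commute:
  fixes f :: "real ^ 'n::finite \<Rightarrow> real"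
  assumes f: "C2_on f U" and "open U" "x \<in> U"
  shows "partial_deriv i (partial_deriv j f) x = partial_deriv j (partial_deriv i f) x"
proof (rule ccontr)
  let ?P = "partial_deriv i (partial_deriv j f)" and ?Q = "partial_deriv j (partial_deriv i f)"
  assume "?P x \<noteq> ?Q x"
  then have e: "\<bar>?P x - ?Q x\<bar> / 2 > 0" by simp
  have "continuous (at x) ?P" "continuous (at x) ?Q"
    using assms continuous_on_eq_continuous_at unfolding C1_on_def C2_on_def by blast+
  then obtain p q where
    p: "p > 0" "\<And>y. dist y x < p \<Longrightarrow> \<bar>?P y - ?P x\<bar> < \<bar>?P x - ?Q x\<bar> / 2" and
    q: "q > 0" "\<And>y. dist y x < q \<Longrightarrow> \<bar>?Q y - ?Q x\<bar> < \<bar>?P x - ?Q x\<bar> / 2"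
    using e unfolding continuous_at_eps_delta dist_real_def by metis
  obtain r where r: "r > 0" "ball x r \<subseteq> U"
    using assms open_contains_ball by blast
  define D where "D = min r (min p q)"
  have D: "D > 0" "ball x D \<subseteq> U" using r p q by (auto simp: D_def)
  note C = C2_on_subset[OF f D(2)]
  have h: "0 < D / 3" "2 * (D / 3) < D" using D by auto
  obtain y where y: "y \<in> ball x D"
    "f (x + (D/3) *\<^sub>R axis i 1 + (D/3) *\<^sub>R axis j 1) - f (x + (D/3) *\<^sub>R axis i 1)
    - f (x + (D/3) *\<^sub>R axis j 1) + f x = (D/3) * (D/3) * ?Q y"
    using double_difference_mvt[OF C h] by blast
  obtain z where z: "z \<in> ball x D"
    "f (x + (D/3) *\<^sub>R axis j 1 + (D/3) *\<^sub>R axis i 1) - f (x + (D/3) *\<^sub>R axis j 1)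
    - f (x + (D/3) *\<^sub>R axis i 1) + f x = (D/3) * (D/3) * ?P z"
    using double_difference_mvt[OF C h] by blast
  have "(D/3) * (D/3) * ?Q y = (D/3) * (D/3) * ?P z"
    using y(2) z(2) by (simp only: add_ac)
  then have "?Q y = ?P z" using h by simp
  moreover have "\<bar>?Q y - ?Q x\<bar> < \<bar>?P x - ?Q x\<bar> / 2" "\<bar>?P z - ?P x\<bar> < \<bar>?P x - ?Q x\<bar> / 2"
    using y(1) z(1) p(2)[of z] q(2)[of y] by (auto simp: D_def dist_commute)
  ultimately show False by (smt (verit) field_sum_of_halves)
qed

lemma C2_on_taylor:
  fixes f :: "real ^ 2 \<Rightarrow> real"
  assumes f: "C2_on f U" and U: "open U" "convex U" and xy: "x \<in> U" "y \<in> U"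
  shows "\<exists>z\<in>closed_segment x y.
    f y = f x + gradient f x \<bullet> (y - x) + (y - x) \<bullet> (hessian f z *v (y - x)) / 2"
proof -
  define d where "d = y - x"
  \<comment> \<open>The derivatives of orders 0, 1 and 2 of \<open>f\<close> along the line through
    \<open>x\<close> and \<open>y\<close>, indexed as Maclaurin's theorem expects.\<close>
  define diff where "diff m = (if m = 0 then \<lambda>t. f (x + t *\<^sub>R d)
     else if m = 1 then \<lambda>t. gradient f (x + t *\<^sub>R d) \<bullet> d
     else (\<lambda>t. d \<bullet> (hessian f (x + t *\<^sub>R d) *v d)))" for m :: nat
  have seg: "x + t *\<^sub>R d \<in> closed_segment x y" if "0 \<le> t" "t \<le> 1" for t
    unfolding in_segment d_def using that by (intro exI[of _ t]) (auto simp: algebra_simps)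
  have inU: "x + t *\<^sub>R d \<in> U" if "0 \<le> t" "t \<le> 1" for t
    using seg[OF that] U(2) xy closed_segment_subset by blast
  have line: "((\<lambda>t. F (x + t *\<^sub>R d)) has_real_derivative gradient F (x + t *\<^sub>R d) \<bullet> d) (at t)"
    if "C1_on F U" "0 \<le> t" "t \<le> 1" for F t
  proof -
    have *: "((\<lambda>t. x + t *\<^sub>R d) has_derivative (\<lambda>t. t *\<^sub>R d)) (at t)"
      by (auto intro!: derivative_eq_intros)
    have "((\<lambda>t. F (x + t *\<^sub>R d)) has_derivative (\<lambda>s. gradient F (x + t *\<^sub>R d) \<bullet> (s *\<^sub>R d))) (at t)"
      by (rule has_derivative_compose[OF *])
         (use C1_on_has_derivative[OF that(1) U(1) inU] that in auto)
    then show ?thesis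
      by (simp add: has_field_derivative_def mult_commute_abs)
  qed
  have step: "(diff m has_real_derivative diff (Suc m) t) (at t)" if "m < 2" "0 \<le> t" "t \<le> 1" for m t
  proof (cases "m = 0")
    case True
    then show ?thesis
      using line[of f t] f that by (simp add: diff_def C2_on_def)
  next
    case False
    then have m: "m = 1" using that by simp
    have "((\<lambda>t. \<Sum>i\<in>UNIV. partial_deriv i f (x + t *\<^sub>R d) * d $ i) has_real_derivative
        (\<Sum>i\<in>UNIV. (gradient (partial_deriv i f) (x + t *\<^sub>R d) \<bullet> d) * d $ i)) (at t)"
      by (intro derivative_intros DERIV_cmult_right line) (use f that in \<open>auto simp: C2_on_def\<close>)
    moreover have "(\<Sum>i\<in>UNIV. (gradient (partial_deriv i f) z \<bullet> d) * d $ i) = d \<bullet> (hessian f z *v d)" for z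
      by (simp add: gradient_def hessian_def inner_vec_def matrix_vector_mult_def sum_2 algebra_simps)
    ultimately show ?thesis
      using m by (simp add: diff_def gradient_def inner_vec_def)
  qed
  obtain t where t: "0 < t" "t < 1"
    "diff 0 1 = (\<Sum>m<2. diff m 0 / fact m * 1 ^ m) + diff 2 t / fact 2 * 1 ^ 2"
    using Maclaurin[of 1 2 diff "diff 0"] step by auto
  have "f y = f x + gradient f x \<bullet> d + d \<bullet> (hessian f (x + t *\<^sub>R d) *v d) / 2"
    using t(3) by (simp add: diff_def numeral_2_eq_2) (simp add: d_def)
  then show ?thesis
    using seg[of t] t unfolding d_def by auto
qed

lemma abs_quadratic_form_le:
  fixes M :: "real ^ 'n ^ 'n::finite"
  shows "\<bar>d \<bullet> (M *v d)\<bar> \<le> (\<Sum>i\<in>UNIV. \<Sum>j\<in>UNIV. \<bar>M $ i $ j\<bar>) * (norm d)\<^sup>2"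
proof -
  have "\<bar>d \<bullet> (M *v d)\<bar> = \<bar>\<Sum>i\<in>UNIV. \<Sum>j\<in>UNIV. d $ i * (M $ i $ j * d $ j)\<bar>"
    by (simp add: inner_vec_def matrix_vector_mult_def sum_distrib_left)
  also have "\<dots> \<le> (\<Sum>i\<in>UNIV. \<Sum>j\<in>UNIV. \<bar>d $ i * (M $ i $ j * d $ j)\<bar>)"
    by (rule order.trans[OF sum_abs sum_mono]) (rule sum_abs)
  also have "\<dots> \<le> (\<Sum>i\<in>UNIV. \<Sum>j\<in>UNIV. \<bar>M $ i $ j\<bar> * (norm d)\<^sup>2)"
  proof (intro sum_mono)
    fix i j
    have "\<bar>d $ i\<bar> * \<bar>d $ j\<bar> \<le> norm d * norm d"
      by (intro mult_mono component_le_norm_cart) auto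
    then have "\<bar>M $ i $ j\<bar> * (\<bar>d $ i\<bar> * \<bar>d $ j\<bar>) \<le> \<bar>M $ i $ j\<bar> * (norm d * norm d)"
      by (rule mult_left_mono) simp
    then show "\<bar>d $ i * (M $ i $ j * d $ j)\<bar> \<le> \<bar>M $ i $ j\<bar> * (norm d)\<^sup>2"
      by (simp add: abs_mult power2_eq_square mult_ac)
  qed
  finally show ?thesis by (simp add: sum_distrib_right)
qed

text \<open>The entrywise distance \<open>?S\<close> of the Hessians is continuous, vanishes at
  \<open>x\<close> and bounds the difference of the forms relative to
  \<open>(norm d)\<^sup>2\<close>. Hence one radius serves all directions.\<close>

lemma C2_on_hessian_near:
  fixes f :: "real ^ 'n::finite \<Rightarrow> real"
  assumes f: "C2_on f U" and U: "open U" "x \<in> U" and e: "e > 0"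
  shows "\<exists>r>0. ball x r \<subseteq> U \<and> (\<forall>y\<in>ball x r. \<forall>d.
    \<bar>d \<bullet> (hessian f y *v d) - d \<bullet> (hessian f x *v d)\<bar> \<le> e * (norm d)\<^sup>2)"
proof -
  let ?S = "\<lambda>y. \<Sum>i\<in>UNIV. \<Sum>j\<in>UNIV. \<bar>(hessian f y - hessian f x) $ i $ j\<bar>"
  have "continuous_on U (partial_deriv i (partial_deriv j f))" for i j
    using f by (simp add: C2_on_def C1_on_def)
  then have "continuous_on U ?S"
    by (auto simp: hessian_def intro!: continuous_intros)
  then have "continuous (at x) ?S"
    using U continuous_on_eq_continuous_at by blast
  then obtain p where p: "p > 0" "\<And>y. dist y x < p \<Longrightarrow> \<bar>?S y - ?S x\<bar> < e"
    using e unfolding continuous_at_eps_delta dist_real_def by metis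
  obtain r where r: "r > 0" "ball x r \<subseteq> U"
    using U open_contains_ball by blast
  have "\<bar>d \<bullet> (hessian f y *v d) - d \<bullet> (hessian f x *v d)\<bar> \<le> e * (norm d)\<^sup>2" if "dist y x < p" for y d
  proof -
    have "\<bar>d \<bullet> ((hessian f y - hessian f x) *v d)\<bar> \<le> ?S y * (norm d)\<^sup>2"
      by (rule abs_quadratic_form_le)
    also have "\<dots> \<le> e * (norm d)\<^sup>2"
      using p(2)[OF that] by (intro mult_right_mono) (auto)
    finally show ?thesis
      by (simp add: matrix_vector_mult_diff_rdistrib inner_diff_right)
  qed
  then show ?thesis
    using p r by (intro exI[of _ "min p r"]) (auto simp: dist_commute)
qed

text \<open>Adding the Taylor expansions for the steps \<open>q\<close> and \<open>- q\<close>
  cancels the gradient term; both intermediate Hessians are compared with the one at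
  \<open>p0\<close>. This bounds the joint effect of two opposite phases.\<close>

lemma C2_on_second_difference_le:
  fixes g :: "real ^ 2 \<Rightarrow> real"
  assumes g: "C2_on g (ball p0 r)"
    and near: "\<And>y d. y \<in> ball p0 r \<Longrightarrow>
      \<bar>d \<bullet> (hessian g y *v d) - d \<bullet> (hessian g p0 *v d)\<bar> \<le> e * (norm d)\<^sup>2"
    and p: "p \<in> ball p0 r" "p + q \<in> ball p0 r" "p - q \<in> ball p0 r"
  shows "(g (p + q) - g p) + (g (p - q) - g p) \<le> q \<bullet> (hessian g p0 *v q) + e * (norm q)\<^sup>2"
proof -
  have *: "g (p + q) - g p \<le> gradient g p \<bullet> q + (q \<bullet> (hessian g p0 *v q) + e * (norm q)\<^sup>2) / 2"
    if pq: "p + q \<in> ball p0 r" for q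
  proof -
    obtain w where w: "w \<in> closed_segment p (p + q)"
      "g (p + q) = g p + gradient g p \<bullet> q + q \<bullet> (hessian g w *v q) / 2"
      using C2_on_taylor[OF g open_ball convex_ball p(1) pq, unfolded add_diff_cancel_left'] ..
    have "w \<in> ball p0 r"
      using w(1) p(1) pq convex_ball closed_segment_subset by blast
    then show ?thesis using near[of w q] w(2) by simp
  qed
  have "hessian g p0 *v (- q) = - (hessian g p0 *v q)"
    using matrix_vector_mult_scaleR[of _ "-1" q] by simp
  then have "g (p - q) - g p \<le> - (gradient g p \<bullet> q) + (q \<bullet> (hessian g p0 *v q) + e * (norm q)\<^sup>2) / 2"
    using *[of "- q"] p(3) by simp
  from add_mono[OF *[OF p(2)] this] show ?thesis
    by (simp only: field_sum_of_halves add.left_commute add.assoc)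
qed

subsection \<open>Strong concavity and stability of concavity under perturbation\<close>

text \<open>A direction of positive curvature would put two points opposite to each other about
  \<open>x\<close> strictly above the tangent plane at \<open>x\<close>, against midpoint
  concavity.\<close>

lemma concave_hessian_nonpos:
  fixes u :: "real ^ 2 \<Rightarrow> real"
  assumes u: "concave_on S u" and U: "open U" "U \<subseteq> S" "C2_on u U" and x: "x \<in> U"
  shows "d \<bullet> (hessian u x *v d) \<le> 0"
proof (rule ccontr)
  define e where "e = d \<bullet> (hessian u x *v d)"
  assume "\<not> ?thesis"
  then have e: "e > 0" by (simp add: e_def)
  then have d: "norm d > 0" by (auto simp: e_def)
  then obtain r where r: "r > 0" "ball x r \<subseteq> U"
    "\<And>y. y \<in> ball x r \<Longrightarrow> \<bar>d \<bullet> (hessian u y *v d) - d \<bullet> (hessian u x *v d)\<bar> \<le> e / (2 * (norm d)\<^sup>2) * (norm d)\<^sup>2"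
    using C2_on_hessian_near[OF U(3,1) x, of "e / (2 * (norm d)\<^sup>2)"] e d
    by (metis divide_pos_pos mult_pos_pos zero_less_numeral zero_less_power)
  have pos: "d \<bullet> (hessian u y *v d) > 0" if "y \<in> ball x r" for y
    using r(3)[OF that] d e by (simp add: e_def[symmetric] abs_le_iff)
  define s where "s = r / (2 * norm d)"
  have s: "s > 0" "s * norm d < r" using r d by (auto simp: s_def)
  have above: "u (x + c *\<^sub>R d) > u x + c * (gradient u x \<bullet> d)" if c: "\<bar>c\<bar> = s" for c
  proof -
    have "x \<in> ball x r" "x + c *\<^sub>R d \<in> ball x r" using r s c by (auto simp: dist_norm)
    from C2_on_taylor[OF C2_on_subset[OF U(3) r(2)] open_ball convex_ball this]
    obtain w where w: "w \<in> closed_segment x (x + c *\<^sub>R d)"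
      "u (x + c *\<^sub>R d) = u x + c * (gradient u x \<bullet> d) + c\<^sup>2 * (d \<bullet> (hessian u w *v d)) / 2"
      by (auto simp: matrix_vector_mult_scaleR power2_eq_square mult.assoc)
    have "w \<in> ball x r"
      using w(1) \<open>x \<in> ball x r\<close> \<open>x + c *\<^sub>R d \<in> ball x r\<close> convex_ball closed_segment_subset by blast
    then have "c\<^sup>2 * (d \<bullet> (hessian u w *v d)) > 0"
      using pos c s by (intro mult_pos_pos) auto
    then show ?thesis using w(2) by simp
  qed
  have "x + s *\<^sub>R d \<in> S" "x - s *\<^sub>R d \<in> S"
    using r s U(2) by (auto simp: dist_norm intro!: subsetD[OF U(2)] subsetD[OF r(2)])
  then have "(1 - 1 / 2) * u (x + s *\<^sub>R d) + 1 / 2 * u (x - s *\<^sub>R d)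
      \<le> u ((1 - 1 / 2) *\<^sub>R (x + s *\<^sub>R d) + (1 / 2) *\<^sub>R (x - s *\<^sub>R d))"
    by (intro concave_onD[OF u]) auto
  also have "(1 - 1 / 2) *\<^sub>R (x + s *\<^sub>R d) + (1 / 2) *\<^sub>R (x - s *\<^sub>R d) = x"
    by (simp add: algebra_simps flip: scaleR_add_left)
  finally show False
    using above[of s] above[of "- s"] s by simp
qed

text \<open>If the form vanished at \<open>d\<close>, it would be maximal there, so its gradient, a
  multiple of \<open>w = A *v d\<close>, would vanish, against nondegeneracy. Concretely, a small
  step from \<open>d\<close> along \<open>w\<close> makes the form positive.\<close>

lemma symmetric_nonpos_definite:
  fixes A :: "real ^ 'n ^ 'n::finite"
  assumes sym: "transpose A = A" and le: "\<And>d. d \<bullet> (A *v d) \<le> 0" and "det A \<noteq> 0" and d: "d \<noteq> 0"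
  shows "d \<bullet> (A *v d) < 0"
proof (rule ccontr)
  assume "\<not> ?thesis"
  then have 0: "d \<bullet> (A *v d) = 0" using le[of d] by simp
  define w where "w = A *v d"
  have "w \<noteq> 0"
  proof
    assume "w = 0"
    moreover have "\<exists>B. B ** A = mat 1"
      using \<open>det A \<noteq> 0\<close> by (metis invertible_def invertible_det_nz)
    ultimately show False
      using d by (auto simp: w_def matrix_left_invertible_ker)
  qed
  have dw: "d \<bullet> (A *v w) = w \<bullet> w"
    by (metis dot_lmul_matrix sym transpose_matrix_vector w_def)
  define m where "m = \<bar>w \<bullet> (A *v w)\<bar>"
  have ww: "w \<bullet> w > 0" using \<open>w \<noteq> 0\<close> by simp
  \<comment> \<open>Small enough for the first-order gain \<open>2 * s * (w \<bullet> w)\<close> to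
    absorb the second-order term, of size \<open>s * s * m\<close>; the \<open>+ 1\<close> covers
    \<open>m = 0\<close>.\<close>
  define s where "s = w \<bullet> w / (m + 1)"
  have s: "s > 0" "s * m \<le> w \<bullet> w"
    using ww by (auto simp: s_def m_def divide_simps)
  have "(d + s *\<^sub>R w) \<bullet> (A *v (d + s *\<^sub>R w)) = s * (2 * (w \<bullet> w) + s * (w \<bullet> (A *v w)))"
    using 0 dw by (simp add: matrix_vector_right_distrib matrix_vector_mult_scaleR inner_add_left
        inner_add_right algebra_simps flip: w_def)
  moreover have "2 * (w \<bullet> w) + s * (w \<bullet> (A *v w)) > 0"
  proof -
    have "s * - (w \<bullet> (A *v w)) \<le> s * m" using s by (intro mult_left_mono) (auto simp: m_def)
    then show ?thesis using s(2) ww by linarith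
  qed
  ultimately show False
    using le[of "d + s *\<^sub>R w"] s by (simp add: mult_le_0_iff)
qed

lemma negative_definite_uniform:
  fixes A :: "real ^ 'n ^ 'n::finite"
  assumes "\<And>d. d \<noteq> 0 \<Longrightarrow> d \<bullet> (A *v d) < 0"
  shows "\<exists>k>0. \<forall>d. d \<bullet> (A *v d) \<le> - k * (norm d)\<^sup>2"
proof -
  let ?q = "\<lambda>d. d \<bullet> (A *v d)"
  have "continuous_on (sphere 0 1) ?q"
    by (intro continuous_intros matrix_vector_mult_linear_continuous_on)
  moreover have "sphere 0 1 \<noteq> ({} :: (real ^ 'n) set)" by simp
  ultimately obtain m where m: "m \<in> sphere 0 1" "\<And>d. d \<in> sphere 0 1 \<Longrightarrow> ?q d \<le> ?q m"
    using continuous_attains_sup[OF compact_sphere] by blast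
  have "m \<noteq> 0" using m(1) by auto
  have "?q d \<le> - (- ?q m) * (norm d)\<^sup>2" for d
  proof (cases "d = 0")
    case False
    define c where "c = d /\<^sub>R norm d"
    have d: "d = norm d *\<^sub>R c" and c: "c \<in> sphere 0 1" using False by (auto simp: c_def)
    have "?q d = (norm d)\<^sup>2 * ?q c"
      by (subst (1 2) d) (simp add: matrix_vector_mult_scaleR power2_eq_square)
    also have "\<dots> \<le> (norm d)\<^sup>2 * ?q m"
      by (intro mult_left_mono m c) auto
    finally show ?thesis by (simp add: mult.commute)
  qed simp
  then show ?thesis
    using assms[OF \<open>m \<noteq> 0\<close>] by (intro exI[of _ "- ?q m"]) auto
qed

text \<open>Near \<open>x\<close> this is Taylor's formula with a uniformly negative definite
  Hessian. For a far \<open>y\<close>, concavity along the segment from \<open>z\<close> to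
  \<open>y\<close> reduces the claim to a point near \<open>z\<close>, at the price of a smaller
  constant. All \<open>y\<close> in \<open>S\<close> are included because the perturbed function
  must be concave on the whole domain.\<close>

lemma concave_strong_supergradient:
  fixes u :: "real ^ 2 \<Rightarrow> real"
  assumes u: "concave_on S u" and S: "bounded S" and U: "open U" "U \<subseteq> S" "C2_on u U"
    and x: "x \<in> U" and det: "det (hessian u x) \<noteq> 0"
  shows "\<exists>r>0. \<exists>k>0. cball x r \<subseteq> U \<and> (\<forall>z\<in>cball x r. \<forall>y\<in>S.
    u y \<le> u z + gradient u z \<bullet> (y - z) - k * (norm (y - z))\<^sup>2)"
proof -
  have "transpose (hessian u x) = hessian u x"
    by (simp add: transpose_def hessian_def vec_eq_iff C2_on_partial_commute[OF U(3,1) x])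
  then obtain k where k: "k > 0" "\<And>d. d \<bullet> (hessian u x *v d) \<le> - k * (norm d)\<^sup>2"
    using negative_definite_uniform symmetric_nonpos_definite concave_hessian_nonpos[OF u U x] det
    by metis
  obtain r where r: "r > 0" "ball x r \<subseteq> U"
    "\<And>y d. y \<in> ball x r \<Longrightarrow> \<bar>d \<bullet> (hessian u y *v d) - d \<bullet> (hessian u x *v d)\<bar> \<le> k / 2 * (norm d)\<^sup>2"
    using C2_on_hessian_near[OF U(3,1) x, of "k / 2"] k by auto
  \<comment> \<open>On the ball the Hessian form is at most \<open>- k / 2\<close> times the squared
    norm; Taylor's factor 1/2 leaves \<open>k / 4\<close>.\<close>
  have local: "u y \<le> u z + gradient u z \<bullet> (y - z) - k / 4 * (norm (y - z))\<^sup>2"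
    if yz: "z \<in> ball x r" "y \<in> ball x r" for y z
  proof -
    obtain w where w: "w \<in> closed_segment z y"
      "u y = u z + gradient u z \<bullet> (y - z) + (y - z) \<bullet> (hessian u w *v (y - z)) / 2"
      using C2_on_taylor[OF C2_on_subset[OF U(3) r(2)] open_ball convex_ball yz] by blast
    have "w \<in> ball x r"
      using w(1) yz convex_ball closed_segment_subset by blast
    then have "(y - z) \<bullet> (hessian u w *v (y - z)) - (y - z) \<bullet> (hessian u x *v (y - z))
        \<le> k / 2 * (norm (y - z))\<^sup>2"
      using r(3)[of w "y - z"] by linarith
    then show ?thesis
      using w(2) k(2)[of "y - z"] by simp
  qed
  obtain B where B: "B > 0" "\<And>y. y \<in> S \<Longrightarrow> norm y \<le> B"
    using S bounded_pos by blast
  \<comment> \<open>The factor \<open>s\<close> pulls all of \<open>S\<close> into the ball, where the local estimate applies.\<close>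
  define s where "s = min 1 (r / 2 / (2 * B))"
  have s: "0 < s" "s \<le> 1" using r B by (auto simp: s_def)
  \<comment> \<open>With \<open>z\<close> within \<open>r / 3\<close> of \<open>x\<close> and the
    contracted point \<open>p\<close> within \<open>r / 2\<close> of \<open>z\<close>,
    \<open>p\<close> stays in \<open>ball x r\<close>.\<close>
  have sub: "cball x (r / 3) \<subseteq> U" using r by (auto intro!: subsetD[OF r(2)])
  have glob: "u y \<le> u z + gradient u z \<bullet> (y - z) - (k / 4 * s) * (norm (y - z))\<^sup>2"
    if z: "z \<in> cball x (r / 3)" and y: "y \<in> S" for z y
  proof -
    have zb: "z \<in> ball x r" using z r by auto
    then have zS: "z \<in> S" using r U(2) by blast
    define p where "p = (1 - s) *\<^sub>R z + s *\<^sub>R y"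
    have pz: "p - z = s *\<^sub>R (y - z)" by (simp add: p_def algebra_simps)
    have "norm (y - z) \<le> 2 * B"
      using B(2)[OF y] B(2)[OF zS] norm_triangle_ineq4[of y z] by linarith
    then have "norm (p - z) \<le> s * (2 * B)" using s unfolding pz by simp
    also have "\<dots> \<le> r / 2" using B by (auto simp: s_def min_def field_simps)
    finally have "dist x p < r"
      using z r dist_triangle[of x p z] by (simp add: dist_norm norm_minus_commute)
    then have "u p \<le> u z + gradient u z \<bullet> (p - z) - k / 4 * (norm (p - z))\<^sup>2"
      using local zb by simp
    also have "\<dots> = u z + s * (gradient u z \<bullet> (y - z) - (k / 4 * s) * (norm (y - z))\<^sup>2)"
      using s unfolding pz norm_scaleR inner_scaleR_right
      by (simp add: power_mult_distrib power2_eq_square[of s] right_diff_distrib)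
    finally have "(1 - s) * u z + s * u y \<le> u z + s * (gradient u z \<bullet> (y - z) - (k / 4 * s) * (norm (y - z))\<^sup>2)"
      using concave_onD[OF u, of s z y] s zS y unfolding p_def by auto
    then have "s * u y \<le> s * (u z + (gradient u z \<bullet> (y - z) - (k / 4 * s) * (norm (y - z))\<^sup>2))"
      by (simp add: algebra_simps)
    then show ?thesis using s by (simp add: mult_le_cancel_left_pos)
  qed
  have "0 < r / 3" "0 < k / 4 * s" using r(1) k(1) s(1) by simp_all
  with sub glob show ?thesis by blast
qed

text \<open>If the intermediate point of a chord lies in the large ball, the quadratic terms cancel
  and \<open>G + H\<close> gives a supergradient of the sum there. Otherwise \<open>\<phi>\<close>
  vanishes at that point, and only an endpoint in the small ball can do harm; strong concavity of
  \<open>u\<close> pays for it.\<close>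

lemma concave_perturbation:
  fixes u \<phi> :: "'a::real_inner \<Rightarrow> real"
  assumes u: "concave_on S u" and R: "0 < R" "R < R'" and k: "k > 0"
    and strong: "\<And>z y. z \<in> cball x0 R' \<Longrightarrow> y \<in> S \<Longrightarrow> u y \<le> u z + G z \<bullet> (y - z) - k * (norm (y - z))\<^sup>2"
    and smooth: "\<And>z y. z \<in> cball x0 R' \<Longrightarrow> y \<in> S \<Longrightarrow> \<phi> y \<le> \<phi> z + H z \<bullet> (y - z) + k * (norm (y - z))\<^sup>2"
    and supp: "\<And>y. y \<notin> cball x0 R \<Longrightarrow> \<phi> y = 0"
    and small: "\<And>y. \<phi> y \<le> k * (R' - R)\<^sup>2"
  shows "concave_on S (\<lambda>y. u y + \<phi> y)"
proof -
  have S: "convex S" using u by (simp add: concave_on_iff)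
  let ?v = "\<lambda>y. u y + \<phi> y"
  have near: "(1 - t) * ?v a + t * ?v b \<le> ?v ((1 - t) *\<^sub>R a + t *\<^sub>R b)"
    if "a \<in> S" "b \<in> S" "0 < t" "t < 1" "(1 - t) *\<^sub>R a + t *\<^sub>R b \<in> cball x0 R'" for a b t
  proof -
    define c where "c = (1 - t) *\<^sub>R a + t *\<^sub>R b"
    have c: "c \<in> cball x0 R'" using that by (simp add: c_def)
    have *: "?v y \<le> ?v c + (G c + H c) \<bullet> (y - c)" if "y \<in> S" for y
      using strong[OF c that] smooth[OF c that] by (simp add: inner_add_left)
    have "(1 - t) * ?v a + t * ?v b \<le>
      (1 - t) * (?v c + (G c + H c) \<bullet> (a - c)) + t * (?v c + (G c + H c) \<bullet> (b - c))"
      using that by (intro add_mono mult_left_mono *) auto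
    also have "\<dots> = ?v c + (G c + H c) \<bullet> ((1 - t) *\<^sub>R (a - c) + t *\<^sub>R (b - c))"
      by (simp add: algebra_simps)
    also have "(1 - t) *\<^sub>R (a - c) + t *\<^sub>R (b - c) = 0"
      by (simp add: c_def algebra_simps)
    finally show ?thesis by (simp add: c_def)
  qed
  \<comment> \<open>Where the perturbation is felt at an endpoint \<open>a\<close> but not at the far point \<open>c\<close>, strong concavity
    at the point \<open>p\<close> of the chord at distance \<open>R' - R\<close> from \<open>a\<close> leaves room for it.\<close>
  have gap: "(1 - t) * (u a + k * (R' - R)\<^sup>2) + t * u b \<le> u ((1 - t) *\<^sub>R a + t *\<^sub>R b)"
    if ab: "a \<in> S" "b \<in> S" "a \<in> cball x0 R" and t: "0 < t" "t < 1"
      and far: "(1 - t) *\<^sub>R a + t *\<^sub>R b \<notin> cball x0 R'" for a b t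
  proof -
    define c where "c = (1 - t) *\<^sub>R a + t *\<^sub>R b"
    have ca: "c - a = t *\<^sub>R (b - a)" by (simp add: c_def algebra_simps)
    have "dist x0 a \<le> R" "dist x0 c > R'" using ab far by (auto simp: c_def)
    then have d: "norm (c - a) > R' - R"
      using dist_triangle[of x0 c a] by (simp add: dist_norm norm_minus_commute)
    define s where "s = t * (R' - R) / norm (c - a)"
    define p where "p = (1 - s) *\<^sub>R a + s *\<^sub>R b"
    have "norm (c - a) > 0" using d R by linarith
    then have s: "0 < s" "s < t"
      using d t R by (auto simp: s_def divide_simps)
    have "norm (p - a) = s / t * norm (c - a)"
      using s t unfolding ca by (simp add: p_def algebra_simps flip: scaleR_diff_right)
    also have "\<dots> = R' - R" using t \<open>norm (c - a) > 0\<close> by (simp add: s_def)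
    finally have pa: "norm (a - p) = R' - R" by (simp add: norm_minus_commute)
    have p: "p \<in> cball x0 R'"
      using dist_triangle[of x0 p a] pa \<open>dist x0 a \<le> R\<close> by (simp add: dist_norm)
    \<comment> \<open>The supergradient plane at \<open>p\<close> lies above the raised value at
      \<open>a\<close> and above \<open>u b\<close>, so the chord joining these values passes below
      \<open>u p\<close>.\<close>
    have "(1 - s) * (u a + k * (R' - R)\<^sup>2) + s * u b
      \<le> (1 - s) * (u p + G p \<bullet> (a - p)) + s * (u p + G p \<bullet> (b - p))"
    proof (rule add_mono[OF mult_left_mono mult_left_mono])
      show "u a + k * (R' - R)\<^sup>2 \<le> u p + G p \<bullet> (a - p)"
        using strong[OF p ab(1)] by (simp add: pa)
      have "0 \<le> k * (norm (b - p))\<^sup>2" using k by simp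
      then show "u b \<le> u p + G p \<bullet> (b - p)"
        using strong[OF p ab(2)] by linarith
    qed (use s t in auto)
    also have "\<dots> = u p + G p \<bullet> ((1 - s) *\<^sub>R (a - p) + s *\<^sub>R (b - p))"
      by (simp add: algebra_simps)
    also have "(1 - s) *\<^sub>R (a - p) + s *\<^sub>R (b - p) = 0"
      by (simp add: p_def algebra_simps)
    finally have up: "(1 - s) * (u a + k * (R' - R)\<^sup>2) + s * u b \<le> u p" by simp
    \<comment> \<open>The weight with which the far point divides the segment from \<open>p\<close>
      to \<open>b\<close>; concavity of \<open>u\<close> carries the estimate on from
      \<open>p\<close> to it.\<close>
    define m where "m = (t - s) / (1 - s)"
    have m: "0 \<le> m" "m \<le> 1" "(1 - m) * (1 - s) = 1 - t" "(1 - m) * s + m = t"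
      using s t by (auto simp: m_def divide_simps) (auto simp: algebra_simps)
    have "p \<in> S"
      using S ab s t unfolding p_def by (intro convexD_alt) auto
    have "(1 - t) * (u a + k * (R' - R)\<^sup>2) + t * u b
      = (1 - m) * ((1 - s) * (u a + k * (R' - R)\<^sup>2) + s * u b) + m * u b"
      unfolding m(3,4)[symmetric] by (simp add: algebra_simps)
    also have "\<dots> \<le> (1 - m) * u p + m * u b"
      using up m by (intro add_mono mult_left_mono) auto
    also have "\<dots> \<le> u ((1 - m) *\<^sub>R p + m *\<^sub>R b)"
      using concave_onD[OF u m(1,2) \<open>p \<in> S\<close> ab(2)] .
    also have "(1 - m) *\<^sub>R p + m *\<^sub>R b = ((1 - m) * (1 - s)) *\<^sub>R a + ((1 - m) * s + m) *\<^sub>R b"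
      by (simp add: p_def algebra_simps)
    finally show ?thesis by (simp only: m)
  qed
  have half: "(1 - t) * ?v a + t * ?v b \<le> ?v ((1 - t) *\<^sub>R a + t *\<^sub>R b)"
    if ab: "a \<in> S" "b \<in> S" "b \<notin> cball x0 R" and t: "0 < t" "t < 1"
      and far: "(1 - t) *\<^sub>R a + t *\<^sub>R b \<notin> cball x0 R'" for a b t
  proof -
    have "(1 - t) *\<^sub>R a + t *\<^sub>R b \<notin> cball x0 R" using far R by auto
    then have 0: "\<phi> b = 0" "\<phi> ((1 - t) *\<^sub>R a + t *\<^sub>R b) = 0"
      using supp ab by auto
    show ?thesis
    proof (cases "a \<in> cball x0 R")
      case True
      have "(1 - t) * ?v a \<le> (1 - t) * (u a + k * (R' - R)\<^sup>2)"
        using t small by (intro mult_left_mono) auto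
      then show ?thesis
        using gap[OF ab(1,2) True t far] 0 by simp
    next
      case False
      then show ?thesis
        using concave_onD[OF u, of t a b] supp[of a] 0 ab t by simp
    qed
  qed
  have main: "(1 - t) * ?v a + t * ?v b \<le> ?v ((1 - t) *\<^sub>R a + t *\<^sub>R b)"
    if ab: "a \<in> S" "b \<in> S" and t: "0 < t" "t < 1" for a b t
  proof (cases "(1 - t) *\<^sub>R a + t *\<^sub>R b \<in> cball x0 R'")
    case True
    then show ?thesis using near that by blast
  next
    case far: False
    \<comment> \<open>By convexity of the small ball, one endpoint lies outside it. If that is
      \<open>a\<close>, the chord is reversed.\<close>
    have "(1 - t) *\<^sub>R a + t *\<^sub>R b \<in> cball x0 R" if "a \<in> cball x0 R" "b \<in> cball x0 R"
      using convexD_alt[OF convex_cball that, of t] t by auto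
    then consider "b \<notin> cball x0 R" | "a \<notin> cball x0 R" using far R by fastforce
    then show ?thesis
    proof cases
      case 1
      then show ?thesis using half ab t far by blast
    next
      case 2
      then show ?thesis
        using half[OF ab(2,1) 2, of "1 - t"] far t by (simp add: add.commute)
    qed
  qed
  have "(1 - t) * ?v a + t * ?v b \<le> ?v ((1 - t) *\<^sub>R a + t *\<^sub>R b)"
    if "a \<in> S" "b \<in> S" "0 \<le> t" "t \<le> 1" for a b t
    using main[OF that(1,2), of t] that by (cases "t = 0 \<or> t = 1") auto
  then show ?thesis
    unfolding concave_on_iff using S by (metis add_diff_cancel_right' le_add_same_cancel2)
qed

subsection \<open>Oscillating perturbations\<close>

lemma abs_cos_diff_le: "\<bar>cos b - cos a\<bar> \<le> \<bar>b - a\<bar>" for a b :: real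
proof -
  have "\<bar>cos b - cos a\<bar> = 2 * (\<bar>sin ((b + a) / 2)\<bar> * \<bar>sin ((a - b) / 2)\<bar>)"
    by (simp add: cos_diff_cos abs_mult)
  also have "\<dots> \<le> 2 * (1 * \<bar>(a - b) / 2\<bar>)"
    by (intro mult_left_mono mult_mono abs_sin_x_le_abs_x) auto
  finally show ?thesis by simp
qed

lemma cos_taylor_bound: "\<bar>cos b - cos a + sin a * (b - a)\<bar> \<le> (b - a)\<^sup>2" for a b :: real
proof -
  define d where "d = b - a"
  have "cos d - 1 = - 2 * (sin (d / 2))\<^sup>2"
    using cos_double_sin[of "d / 2"] by simp
  moreover have "\<bar>sin (d / 2)\<bar>\<^sup>2 \<le> \<bar>d / 2\<bar>\<^sup>2"
    by (intro power_mono abs_sin_x_le_abs_x) auto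
  ultimately have c: "\<bar>cos d - 1\<bar> \<le> d\<^sup>2 / 2"
    by (simp add: power_divide)
  have s: "\<bar>sin d - d\<bar> \<le> d\<^sup>2 / 2"
    using Maclaurin_sin_bound[of d 2] by (simp add: numeral_2_eq_2 sin_coeff_def)
  have b: "b = a + d" by (simp add: d_def)
  have "cos b - cos a + sin a * (b - a) = cos a * (cos d - 1) - sin a * (sin d - d)"
    unfolding b cos_add by (simp add: algebra_simps)
  also have "\<bar>\<dots>\<bar> \<le> \<bar>cos a\<bar> * \<bar>cos d - 1\<bar> + \<bar>sin a\<bar> * \<bar>sin d - d\<bar>"
    by (rule order.trans[OF abs_triangle_ineq4]) (simp add: abs_mult)
  also have "\<dots> \<le> 1 * (d\<^sup>2 / 2) + 1 * (d\<^sup>2 / 2)"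
    by (intro add_mono mult_mono c s) auto
  finally show ?thesis by (simp add: d_def)
qed

text \<open>The squared positive part has the Lipschitz derivative \<open>2 * max 0 a\<close>. Its
  second derivative jumps at 0, but a quadratic remainder bound is all that the concavity argument
  asks for.\<close>

lemma max_square_taylor_bound:
  "\<bar>(max 0 b)\<^sup>2 - (max 0 a)\<^sup>2 - 2 * max 0 a * (b - a)\<bar> \<le> (b - a)\<^sup>2" for a b :: real
proof (cases "a \<ge> 0"; cases "b \<ge> 0")
  assume "a \<ge> 0" "b \<ge> 0"
  then have "(max 0 b)\<^sup>2 - (max 0 a)\<^sup>2 - 2 * max 0 a * (b - a) = (b - a)\<^sup>2"
    by (simp add: power2_eq_square algebra_simps)
  then show ?thesis by simp
next
  assume *: "a \<ge> 0" "\<not> b \<ge> 0"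
  then have "a * b \<le> 0" by (simp add: mult_nonneg_nonpos)
  moreover have "0 \<le> a * a" "0 \<le> b * b" by auto
  ultimately have "\<bar>a * a - 2 * (a * b)\<bar> \<le> a * a - 2 * (a * b) + b * b" by linarith
  then show ?thesis using * by (simp add: power2_eq_square algebra_simps)
next
  assume *: "\<not> a \<ge> 0" "b \<ge> 0"
  then have "b\<^sup>2 \<le> (b - a)\<^sup>2" by (intro power_mono) auto
  then show ?thesis using * by simp
qed simp

text \<open>Squaring the positive part makes the gradient vanish on the boundary sphere, so that it
  is Lipschitz across it and all bounds stay explicit.\<close>

definition bump :: "'a::real_inner \<Rightarrow> real \<Rightarrow> 'a \<Rightarrow> real" where
  "bump x0 R x = (max 0 (R\<^sup>2 - (norm (x - x0))\<^sup>2))\<^sup>2"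

definition bump_grad :: "'a::real_inner \<Rightarrow> real \<Rightarrow> 'a \<Rightarrow> 'a" where
  "bump_grad x0 R x = (- 4 * max 0 (R\<^sup>2 - (norm (x - x0))\<^sup>2)) *\<^sub>R (x - x0)"

definition wave :: "'a::real_inner \<Rightarrow> real \<Rightarrow> 'a \<Rightarrow> real \<Rightarrow> 'a \<Rightarrow> real" where
  "wave x0 R k \<theta> x = bump x0 R x * cos (k \<bullet> x + \<theta>)"

definition wave_grad :: "'a::real_inner \<Rightarrow> real \<Rightarrow> 'a \<Rightarrow> real \<Rightarrow> 'a \<Rightarrow> 'a" where
  "wave_grad x0 R k \<theta> x = cos (k \<bullet> x + \<theta>) *\<^sub>R bump_grad x0 R x - (bump x0 R x * sin (k \<bullet> x + \<theta>)) *\<^sub>R k"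

lemma bump_eq_0: "x \<notin> cball x0 R \<Longrightarrow> R > 0 \<Longrightarrow> bump x0 R x = 0"
  by (simp add: bump_def dist_norm norm_minus_commute power_mono max_def)

lemma bump_nonneg: "0 \<le> bump x0 R x"
  by (simp add: bump_def)

lemma bump_le: "bump x0 R x \<le> (R\<^sup>2)\<^sup>2"
  unfolding bump_def by (intro power_mono) auto

lemma norm_bump_grad_le:
  assumes "dist x0 x \<le> D"
  shows "norm (bump_grad x0 R x) \<le> 4 * R\<^sup>2 * D"
proof -
  have "\<bar>max 0 (R\<^sup>2 - (norm (x - x0))\<^sup>2)\<bar> * norm (x - x0) \<le> R\<^sup>2 * D"
    using assms by (intro mult_mono) (auto simp: dist_norm norm_minus_commute)
  then show ?thesis by (simp add: bump_grad_def abs_mult)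
qed

lemma wave_eq_0: "x \<notin> cball x0 R \<Longrightarrow> R > 0 \<Longrightarrow> wave x0 R k \<theta> x = 0"
  by (simp add: wave_def bump_eq_0)

lemma abs_wave_le: "\<bar>wave x0 R k \<theta> x\<bar> \<le> (R\<^sup>2)\<^sup>2"
proof -
  have "\<bar>wave x0 R k \<theta> x\<bar> \<le> (R\<^sup>2)\<^sup>2 * 1"
    unfolding wave_def abs_mult using bump_le[of x0 R x] bump_nonneg[of x0 R x]
    by (intro mult_mono) auto
  then show ?thesis by simp
qed

text \<open>The outer square is expanded by \<open>max_square_taylor_bound\<close>. The inner
  increment \<open>b - a\<close> has size at most \<open>4 * (D * n)\<close>, whence
  \<open>16 * D\<^sup>2\<close>; its quadratic part, absent from \<open>bump_grad\<close>,
  contributes \<open>2 * R\<^sup>2\<close>.\<close>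

lemma bump_taylor_bound:
  assumes "dist x0 y \<le> D" "dist x0 z \<le> D"
  shows "\<bar>bump x0 R y - bump x0 R z - bump_grad x0 R z \<bullet> (y - z)\<bar> \<le> (16 * D\<^sup>2 + 2 * R\<^sup>2) * (norm (y - z))\<^sup>2"
proof -
  define n where "n = norm (y - z)"
  define a where "a = R\<^sup>2 - (norm (z - x0))\<^sup>2"
  define b where "b = R\<^sup>2 - (norm (y - x0))\<^sup>2"
  have n: "0 \<le> n" "n \<le> 2 * D"
    using assms dist_triangle[of y z x0] by (auto simp: n_def dist_norm norm_minus_commute)
  have ba: "b - a = - 2 * ((z - x0) \<bullet> (y - z)) - n\<^sup>2"
    by (simp add: a_def b_def n_def power2_norm_eq_inner algebra_simps inner_commute)
  have "\<bar>(z - x0) \<bullet> (y - z)\<bar> \<le> D * n"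
    unfolding n_def using assms
    by (intro order.trans[OF Cauchy_Schwarz_ineq2] mult_right_mono)
       (auto simp: dist_norm norm_minus_commute)
  moreover have "n\<^sup>2 \<le> 2 * (D * n)"
    using mult_right_mono[OF n(2) n(1)] by (simp add: power2_eq_square)
  ultimately have "\<bar>b - a\<bar> \<le> 4 * (D * n)"
    unfolding ba using zero_le_power2[of n] by linarith
  then have "(b - a)\<^sup>2 \<le> (4 * (D * n))\<^sup>2"
    by (metis abs_ge_zero power2_abs power_mono)
  then have 1: "\<bar>(max 0 b)\<^sup>2 - (max 0 a)\<^sup>2 - 2 * max 0 a * (b - a)\<bar> \<le> 16 * D\<^sup>2 * n\<^sup>2"
    using max_square_taylor_bound[of b a] by (simp add: power_mult_distrib)
  have 2: "\<bar>2 * max 0 a * n\<^sup>2\<bar> \<le> 2 * R\<^sup>2 * n\<^sup>2"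
    by (simp add: abs_mult mult_right_mono a_def)
  have "bump x0 R y - bump x0 R z - bump_grad x0 R z \<bullet> (y - z) =
    ((max 0 b)\<^sup>2 - (max 0 a)\<^sup>2 - 2 * max 0 a * (b - a)) - 2 * max 0 a * n\<^sup>2"
    unfolding ba by (simp add: bump_def bump_grad_def a_def[symmetric] b_def[symmetric] algebra_simps)
  also have "\<bar>\<dots>\<bar> \<le> 16 * D\<^sup>2 * n\<^sup>2 + 2 * R\<^sup>2 * n\<^sup>2"
    by (intro order.trans[OF abs_triangle_ineq4] add_mono 1 2)
  finally show ?thesis by (simp add: n_def algebra_simps)
qed

text \<open>The constant is uniform over a ball that will contain the whole domain, so that a single
  amplitude suits all pairs of points.\<close>

lemma wave_taylor_bound:
  assumes "dist x0 y \<le> D" "dist x0 z \<le> D"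
  shows "\<bar>wave x0 R k \<theta> y - wave x0 R k \<theta> z - wave_grad x0 R k \<theta> z \<bullet> (y - z)\<bar>
    \<le> (16 * D\<^sup>2 + 2 * R\<^sup>2 + 4 * R\<^sup>2 * D * norm k + (R\<^sup>2)\<^sup>2 * (norm k)\<^sup>2) * (norm (y - z))\<^sup>2"
proof -
  define n where "n = norm (y - z)"
  define f1 f2 p where "f1 = bump x0 R z" and "f2 = bump x0 R y" and "p = bump_grad x0 R z \<bullet> (y - z)"
  define g1 g2 q where "g1 = cos (k \<bullet> z + \<theta>)" and "g2 = cos (k \<bullet> y + \<theta>)"
    and "q = - sin (k \<bullet> z + \<theta>) * (k \<bullet> (y - z))"
  have kn: "\<bar>k \<bullet> (y - z)\<bar> \<le> norm k * n"
    unfolding n_def by (rule Cauchy_Schwarz_ineq2)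
  have f: "\<bar>f2 - f1 - p\<bar> \<le> (16 * D\<^sup>2 + 2 * R\<^sup>2) * n\<^sup>2"
    unfolding f1_def f2_def p_def n_def by (rule bump_taylor_bound) fact+
  have p: "\<bar>p\<bar> \<le> 4 * R\<^sup>2 * D * n"
    unfolding p_def n_def
    by (intro order.trans[OF Cauchy_Schwarz_ineq2] mult_right_mono norm_bump_grad_le assms) auto
  have g12: "\<bar>g2 - g1\<bar> \<le> norm k * n"
    using abs_cos_diff_le[of "k \<bullet> y + \<theta>" "k \<bullet> z + \<theta>"] kn
    by (simp add: g1_def g2_def inner_diff_right)
  have "\<bar>g2 - g1 - q\<bar> \<le> (k \<bullet> (y - z))\<^sup>2"
    using cos_taylor_bound[of "k \<bullet> y + \<theta>" "k \<bullet> z + \<theta>"]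
    by (simp add: g1_def g2_def q_def inner_diff_right)
  also have "\<dots> \<le> (norm k * n)\<^sup>2"
    using kn by (metis abs_ge_zero power2_abs power_mono)
  finally have g: "\<bar>g2 - g1 - q\<bar> \<le> (norm k * n)\<^sup>2" .
  \<comment> \<open>Product rule with remainders: \<open>f2 - f1 - p\<close> and
    \<open>g2 - g1 - q\<close> are of second order, and \<open>p * (g2 - g1)\<close> is a product of
    two first-order terms.\<close>
  have "wave x0 R k \<theta> y - wave x0 R k \<theta> z - wave_grad x0 R k \<theta> z \<bullet> (y - z)
    = (f2 - f1 - p) * g2 + p * (g2 - g1) + f1 * (g2 - g1 - q)"
    by (simp add: wave_def wave_grad_def f1_def f2_def g1_def g2_def p_def q_def algebra_simps)
  also have "\<bar>\<dots>\<bar> \<le> \<bar>f2 - f1 - p\<bar> * \<bar>g2\<bar> + \<bar>p\<bar> * \<bar>g2 - g1\<bar> + \<bar>f1\<bar> * \<bar>g2 - g1 - q\<bar>"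
    by (simp only: abs_mult[symmetric])
  also have "\<dots> \<le> ((16 * D\<^sup>2 + 2 * R\<^sup>2) * n\<^sup>2) * 1 + (4 * R\<^sup>2 * D * n) * (norm k * n) + (R\<^sup>2)\<^sup>2 * (norm k * n)\<^sup>2"
    using bump_le[of x0 R z] bump_nonneg[of x0 R z] order.trans[OF zero_le_dist assms(1)]
    by (intro add_mono mult_mono f g p g12) (auto simp: g2_def f1_def n_def)
  finally show ?thesis by (simp add: n_def algebra_simps power2_eq_square)
qed

lemma wave_has_derivative:
  "(wave x0 R k \<theta> has_derivative (\<lambda>h. wave_grad x0 R k \<theta> x \<bullet> h)) (at x)"
  unfolding has_derivative_iff_norm
proof (intro conjI bounded_linear_inner_right)
  let ?Q = "\<lambda>y. norm (wave x0 R k \<theta> y - wave x0 R k \<theta> x - wave_grad x0 R k \<theta> x \<bullet> (y - x)) / norm (y - x)"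
  define D where "D = dist x0 x + 1"
  define C where "C = 16 * D\<^sup>2 + 2 * R\<^sup>2 + 4 * R\<^sup>2 * D * norm k + (R\<^sup>2)\<^sup>2 * (norm k)\<^sup>2"
  have "?Q y \<le> C * norm (y - x)" if "y \<noteq> x" "dist y x < 1" for y
  proof -
    have "dist x0 y \<le> D" "dist x0 x \<le> D"
      using that dist_triangle[of x0 y x] by (auto simp: D_def dist_commute)
    from wave_taylor_bound[OF this, of R k \<theta>] show ?thesis
      using that by (simp add: C_def divide_simps power2_eq_square mult_ac)
  qed
  then have "\<forall>\<^sub>F y in at x. norm (?Q y) \<le> C * norm (y - x)"
    by (auto simp: eventually_at intro!: exI[of _ 1])
  moreover have "((\<lambda>y. C * norm (y - x)) \<longlongrightarrow> C * norm (x - x)) (at x)"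
    by (intro tendsto_intros)
  ultimately show "(?Q \<longlongrightarrow> 0) (at x)"
    by (intro Lim_null_comparison[where f = ?Q]) simp_all
qed

lemma continuous_on_bump_grad: "continuous_on S (bump_grad x0 R)"
  unfolding bump_grad_def by (intro continuous_intros)

lemma continuous_on_bump: "continuous_on S (bump x0 R)"
  unfolding bump_def by (intro continuous_intros)

lemma continuous_on_wave_grad: "continuous_on S (wave_grad x0 R k \<theta>)"
  unfolding wave_grad_def by (intro continuous_intros continuous_on_bump continuous_on_bump_grad)

lemma norm_wave_grad_le:
  assumes "dist x0 x \<le> D"
  shows "norm (wave_grad x0 R k \<theta> x) \<le> 4 * R\<^sup>2 * D + (R\<^sup>2)\<^sup>2 * norm k"
proof -
  have "norm (wave_grad x0 R k \<theta> x)
    \<le> \<bar>cos (k \<bullet> x + \<theta>)\<bar> * norm (bump_grad x0 R x) + bump x0 R x * \<bar>sin (k \<bullet> x + \<theta>)\<bar> * norm k"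
    unfolding wave_grad_def
    by (rule order.trans[OF norm_triangle_ineq4]) (simp add: abs_mult bump_nonneg)
  also have "\<dots> \<le> 1 * (4 * R\<^sup>2 * D) + (R\<^sup>2)\<^sup>2 * 1 * norm k"
    using order.trans[OF zero_le_dist assms]
    by (intro add_mono mult_mono norm_bump_grad_le assms bump_le) (auto simp: bump_nonneg)
  finally show ?thesis by simp
qed

text \<open>With \<open>b\<close> the bump gradient and \<open>h\<close> the bump, the two gradients
  arise from the pair \<open>b\<close>, \<open>- h *\<^sub>R k\<close> by a rotation through the
  angle \<open>k \<bullet> x\<close>, and a rotation preserves the sum of a quadratic form over a
  pair.\<close>

lemma wave_grad_quadratic_sum:
  fixes A :: "real ^ 'n ^ 'n::finite" and e :: real
  defines "Q \<equiv> \<lambda>q. q \<bullet> (A *v q) + e * (norm q)\<^sup>2"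
  shows "Q (wave_grad x0 R k 0 x) + Q (wave_grad x0 R k (pi / 2) x)
    = (bump x0 R x)\<^sup>2 * Q k + Q (bump_grad x0 R x)"
proof -
  \<comment> \<open>\<open>B\<close> need not be symmetric; cross terms enter only as
    \<open>B p q + B q p\<close>, with opposite coefficients for the two phases.\<close>
  define B where "B p q = p \<bullet> (A *v q) + e * (p \<bullet> q)" for p q
  have BQ: "Q p = B p p" for p
    by (simp add: Q_def B_def power2_norm_eq_inner)
  have B_lin: "B (a *\<^sub>R p + b *\<^sub>R q) (a *\<^sub>R p + b *\<^sub>R q)
    = a\<^sup>2 * B p p + b\<^sup>2 * B q q + a * b * (B p q + B q p)" for a b p q
    by (simp add: B_def matrix_vector_right_distrib matrix_vector_mult_scaleR inner_add_left
        inner_add_right power2_eq_square algebra_simps)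
  define c s h b where "c = cos (k \<bullet> x)" and "s = sin (k \<bullet> x)" and "h = bump x0 R x"
    and "b = bump_grad x0 R x"
  have w: "wave_grad x0 R k 0 x = c *\<^sub>R b + (- h * s) *\<^sub>R k"
    "wave_grad x0 R k (pi / 2) x = (- s) *\<^sub>R b + (- h * c) *\<^sub>R k"
    by (simp_all add: wave_grad_def c_def s_def h_def b_def cos_add sin_add)
  have "Q (wave_grad x0 R k 0 x) + Q (wave_grad x0 R k (pi / 2) x)
     = (c\<^sup>2 + s\<^sup>2) * (h\<^sup>2 * B k k + B b b)"
    unfolding w BQ B_lin by (simp add: power_mult_distrib algebra_simps)
  also have "c\<^sup>2 + s\<^sup>2 = 1" by (simp add: c_def s_def)
  finally show ?thesis by (simp add: BQ h_def b_def)
qed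

lemma wave_grad_add_pi: "wave_grad x0 R k (\<theta> + pi) x = - wave_grad x0 R k \<theta> x"
  by (simp add: wave_grad_def flip: add.assoc)

subsection \<open>The second variation\<close>

lemma integrable_indicator_compact:
  fixes f :: "'a::euclidean_space \<Rightarrow> real"
  assumes "compact S" "continuous_on S f"
  shows "integrable lebesgue (\<lambda>x. indicator S x * f x)"
proof -
  have "integrable lborel (\<lambda>x. indicator S x * f x)"
    using borel_integrable_compact[OF assms] by simp
  then show ?thesis
    by (simp add: integrable_completion borel_measurable_integrable)
qed

lemma integral_bump_square_pos:
  assumes "R > 0"
  shows "0 < (LINT x|lebesgue. indicator (cball (x0 :: 'a::euclidean_space) R) x * (bump x0 R x)\<^sup>2)"
proof -
  \<comment> \<open>The squared bump at distance \<open>R / 2\<close> from the centre, hence a lower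
    bound for it on the half ball.\<close>
  define c where "c = ((R\<^sup>2 - (R / 2)\<^sup>2)\<^sup>2)\<^sup>2"
  have c: "c > 0" using assms by (simp add: c_def power2_eq_square field_simps)
  have "0 < c * measure lebesgue (cball x0 (R / 2))"
    using c assms content_cball_pos[of "R / 2" x0] by simp
  also have "\<dots> = (LINT x|lebesgue. indicator (cball x0 (R / 2)) x * c)"
    by simp
  also have "\<dots> \<le> (LINT x|lebesgue. indicator (cball x0 R) x * (bump x0 R x)\<^sup>2)"
  proof (rule integral_mono)
    show "integrable lebesgue (\<lambda>x. indicator (cball x0 (R / 2)) x * c)"
      "integrable lebesgue (\<lambda>x. indicator (cball x0 R) x * (bump x0 R x)\<^sup>2)"
      by (intro integrable_indicator_compact continuous_intros continuous_on_bump; simp)+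
    fix x
    have "c \<le> (bump x0 R x)\<^sup>2" if x: "x \<in> cball x0 (R / 2)"
    proof -
      have "(norm (x - x0))\<^sup>2 \<le> (R / 2)\<^sup>2"
        using x by (intro power_mono) (auto simp: dist_norm norm_minus_commute)
      moreover have "(R / 2)\<^sup>2 \<le> R\<^sup>2" using assms by (intro power_mono) auto
      ultimately show ?thesis
        unfolding c_def bump_def by (intro power_mono) auto
    qed
    then show "indicator (cball x0 (R / 2)) x * c \<le> indicator (cball x0 R) x * (bump x0 R x)\<^sup>2"
      using assms by (auto simp: indicator_def)
  qed
  finally show ?thesis .
qed

text \<open>Off the closed ball \<open>w\<close> vanishes on a neighbourhood, so the gradients of
  \<open>u + w\<close> and \<open>u\<close> agree even where \<open>u\<close> is not differentiable.
  On the ball everything is continuous, so the energies differ by an integral of a continuous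
  function over a compact set.\<close>

lemma energy_perturbation:
  fixes u w g :: "real ^ 2 \<Rightarrow> real"
  assumes fin: "has_finite_energy \<Omega> g u" and U: "open U" "U \<subseteq> \<Omega>" and u: "C1_on u U"
    and g: "continuous_on UNIV g" and sub: "cball x0 R \<subseteq> U"
    and w: "\<And>x. (w has_derivative (\<lambda>h. W x \<bullet> h)) (at x)" and W: "continuous_on UNIV W"
    and supp: "\<And>x. x \<notin> cball x0 R \<Longrightarrow> w x = 0"
  defines "F \<equiv> \<lambda>x. indicator (cball x0 R) x * (g (gradient u x + W x) - g (gradient u x))"
  shows "has_finite_energy \<Omega> g (\<lambda>x. u x + w x)" "integrable lebesgue F"
    "energy \<Omega> g (\<lambda>x. u x + w x) = energy \<Omega> g u + (LINT x|lebesgue. F x)"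
proof -
  have grad_in: "gradient (\<lambda>x. u x + w x) x = gradient u x + W x" if "x \<in> U" for x
  proof (rule gradient_eqI)
    show "((\<lambda>x. u x + w x) has_derivative (\<lambda>h. (gradient u x + W x) \<bullet> h)) (at x)"
      using has_derivative_add[OF C1_on_has_derivative[OF u U(1) that] w]
      by (simp add: inner_add_left)
  qed
  have grad_out: "gradient (\<lambda>x. u x + w x) x = gradient u x" if "x \<notin> cball x0 R" for x
  proof (rule gradient_cong_ev)
    have "open (- cball x0 R)" by auto
    then show "\<forall>\<^sub>F y in nhds x. u y + w y = u y"
      using supp that by (auto simp: eventually_nhds intro!: exI[of _ "- cball x0 R"])
  qed
  have eq: "indicator \<Omega> x *\<^sub>R g (gradient (\<lambda>x. u x + w x) x) = indicator \<Omega> x *\<^sub>R g (gradient u x) + F x" for x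
  proof (cases "x \<in> cball x0 R")
    case True
    then have "x \<in> U" "x \<in> \<Omega>" using sub U by auto
    then show ?thesis using grad_in True by (simp add: F_def)
  next
    case False
    then show ?thesis by (simp add: F_def grad_out del: mem_cball)
  qed
  have "continuous_on (cball x0 R) (gradient u)"
    using u sub unfolding gradient_def C1_on_def
    by (intro continuous_intros) (auto intro: continuous_on_subset)
  then show F: "integrable lebesgue F"
    unfolding F_def
    by (intro integrable_indicator_compact continuous_intros continuous_on_compose2[OF g]
        continuous_on_subset[OF W]) auto
  have i: "integrable lebesgue (\<lambda>x. indicator \<Omega> x *\<^sub>R g (gradient u x))"
    using fin by (simp add: has_finite_energy_def set_integrable_def)
  show "has_finite_energy \<Omega> g (\<lambda>x. u x + w x)"
    unfolding has_finite_energy_def set_integrable_def eq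
    by (intro Bochner_Integration.integrable_add i F)
  show "energy \<Omega> g (\<lambda>x. u x + w x) = energy \<Omega> g u + (LINT x|lebesgue. F x)"
    unfolding energy_def set_lebesgue_integral_def eq
    by (intro Bochner_Integration.integral_add i F)
qed

lemma small_scale_exists:
  fixes a1 a2 a3 a4 :: real
  assumes "0 \<le> a1" "0 \<le> a2" "0 \<le> a3" "0 < b1" "0 < b2" "0 < b3"
  shows "\<exists>t>0. t * a1 \<le> b1 \<and> t * a2 \<le> b2 \<and> t * a3 \<le> b3"
proof -
  have *: "0 < b / (a + 1) \<and> (\<forall>t\<in>{0..b / (a + 1)}. t * a \<le> b)" if "0 \<le> a" "0 < b" for a b :: real
  proof (intro conjI ballI)
    fix t assume t: "t \<in> {0..b / (a + 1)}"
    have "t * a \<le> t * (a + 1)" using t by (intro mult_left_mono) auto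
    also have "\<dots> \<le> b" using t that by (simp add: field_simps)
    finally show "t * a \<le> b" .
  qed (use that in simp)
  define t where "t = min (b1 / (a1 + 1)) (min (b2 / (a2 + 1)) (b3 / (a3 + 1)))"
  have "0 < t" using * assms by (simp add: t_def)
  then show ?thesis
    using *[of a1 b1] *[of a2 b2] *[of a3 b3] assms by (intro exI[of _ t]) (auto simp: t_def)
qed

theorem theorem1:
  fixes \<Omega> U :: "(real ^ 2) set" and M :: real and g u :: "real ^ 2 \<Rightarrow> real"
  assumes "convex_body \<Omega>" and "M > 0"
    and "C2_on g UNIV"
    and "\<And>p. \<exists>l<0. is_eigenvalue (hessian g p) l"
    and "is_solution \<Omega> M g u"
    and "open U" and "U \<subseteq> \<Omega>"
    and "C2_on u U"
    and "\<And>x. x \<in> U \<Longrightarrow> u x < M"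
  shows "\<forall>x\<in>U. det (hessian u x) = 0"
proof (rule ballI, rule ccontr)
  fix x0 assume x0: "x0 \<in> U" and det: "det (hessian u x0) \<noteq> 0"
  have conc: "concave_on \<Omega> u" and u0: "\<And>x. x \<in> \<Omega> \<Longrightarrow> 0 \<le> u x" and uM: "\<And>x. x \<in> \<Omega> \<Longrightarrow> u x \<le> M"
    and fin: "has_finite_energy \<Omega> g u"
    and opt: "\<And>v. admissible \<Omega> M v \<Longrightarrow> has_finite_energy \<Omega> g v \<Longrightarrow> energy \<Omega> g u \<le> energy \<Omega> g v"
    using assms(5) by (auto simp: is_solution_def admissible_def)
  have bdd: "bounded \<Omega>"
    using assms(1) by (auto simp: convex_body_def compact_imp_bounded)
  have u1: "C1_on u U" and g1: "C1_on g UNIV"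
    using assms(3,8) by (auto simp: C2_on_def)
  have cont_u: "continuous_on U u"
    by (intro continuous_at_imp_continuous_on ballI
        has_derivative_continuous[OF C1_on_has_derivative[OF u1 assms(6)]])
  have cont_g: "continuous_on UNIV g"
    by (intro continuous_at_imp_continuous_on ballI
        has_derivative_continuous[OF C1_on_has_derivative[OF g1 open_UNIV]])

  \<comment> \<open>A direction of negative curvature of \<open>g\<close>\<close>
  define p0 where "p0 = gradient u x0"
  obtain l v where l: "l < 0" and v: "v \<noteq> 0" "hessian g p0 *v v = l *s v"
    using assms(4) unfolding is_eigenvalue_def by blast
  \<comment> \<open>Half of the eigenvalue is given away as tolerance: \<open>Q\<close> is still
    negative at \<open>v\<close>, yet dominates the Hessian form of \<open>g\<close> at every point
    of \<open>ball p0 d\<close>.\<close>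
  define e where "e = - l / 2"
  have e: "e > 0" using l by (simp add: e_def)
  define Q where "Q q = q \<bullet> (hessian g p0 *v q) + e * (norm q)\<^sup>2" for q
  have Q_scale: "Q (c *\<^sub>R q) = c\<^sup>2 * Q q" for c q
    by (simp add: Q_def matrix_vector_mult_scaleR power2_eq_square algebra_simps)
  have "Q v = l / 2 * (norm v)\<^sup>2"
    by (simp add: Q_def v(2) e_def power2_norm_eq_inner scalar_mult_eq_scaleR)
  also have "\<dots> < 0" using l v by (intro mult_neg_pos) auto
  finally have Qv: "Q v < 0" .
  have cont_Q: "continuous_on UNIV Q"
    unfolding Q_def by (intro continuous_intros matrix_vector_mult_linear_continuous_on)
  obtain d where d: "d > 0" "\<And>y q. y \<in> ball p0 d \<Longrightarrow>
      \<bar>q \<bullet> (hessian g y *v q) - q \<bullet> (hessian g p0 *v q)\<bar> \<le> e * (norm q)\<^sup>2"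
    using C2_on_hessian_near[OF assms(3) open_UNIV UNIV_I e] by metis

  \<comment> \<open>A ball where \<open>u\<close> is strongly concave and stays away from 0 and
    \<open>M\<close>\<close>
  obtain r1 \<kappa> where r1: "r1 > 0" "cball x0 r1 \<subseteq> U" and \<kappa>: "\<kappa> > 0"
    and strong: "\<And>z y. z \<in> cball x0 r1 \<Longrightarrow> y \<in> \<Omega> \<Longrightarrow>
      u y \<le> u z + gradient u z \<bullet> (y - z) - \<kappa> * (norm (y - z))\<^sup>2"
    using concave_strong_supergradient[OF conc bdd assms(6-8) x0 det] by metis
  have "continuous_on U (gradient u)"
    using u1 unfolding gradient_def C1_on_def by (intro continuous_intros) auto
  then have "continuous (at x0) (gradient u)"
    using x0 assms(6) continuous_on_eq_continuous_at by blast
  then obtain r2 where r2: "r2 > 0" "\<And>y. dist y x0 < r2 \<Longrightarrow> dist (gradient u y) p0 < d / 2"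
    using d(1) unfolding continuous_at_eps_delta p0_def by (metis half_gt_zero)
  \<comment> \<open>Halving fits both radii for \<open>concave_perturbation\<close>,
    \<open>R\<close> and \<open>2 * R\<close>, into the ball of strong concavity and keeps
    \<open>gradient u\<close> within \<open>d / 2\<close> of \<open>p0\<close> on
    \<open>cball x0 R\<close>.\<close>
  define R where "R = min r1 r2 / 2"
  have R: "R > 0" "2 * R \<le> r1" "R < r2" using r1 r2 by (auto simp: R_def)
  have sub2: "cball x0 (2 * R) \<subseteq> cball x0 r1" using R by auto
  have subU: "cball x0 R \<subseteq> U" and sub\<Omega>: "cball x0 (2 * R) \<subseteq> \<Omega>"
    using sub2 r1(2) R assms(7) by (auto simp: subset_iff)

  obtain m where m: "m > 0" "\<And>x. x \<in> cball x0 R \<Longrightarrow> m \<le> u x" "\<And>x. x \<in> cball x0 R \<Longrightarrow> u x \<le> M - m"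
  proof -
    have "cball x0 R \<noteq> {}" using R by simp
    then obtain s where s: "s \<in> cball x0 R" "\<And>x. x \<in> cball x0 R \<Longrightarrow> u x \<le> u s"
      using continuous_attains_sup[OF compact_cball _ continuous_on_subset[OF cont_u subU]] by blast
    \<comment> \<open>Adding the strong supergradient inequalities at \<open>x\<close> for
      \<open>x + a\<close> and \<open>x - a\<close> cancels the gradient; \<open>u\<close> is
      nonnegative at both points.\<close>
    have low: "\<kappa> * R\<^sup>2 \<le> u x" if x: "x \<in> cball x0 R" for x
    proof -
      define a :: "real ^ 2" where "a = R *\<^sub>R axis 1 1"
      have a: "norm a = R" using R by (simp add: a_def norm_axis_1)
      have "dist x0 x \<le> R" using x by simp
      then have "x + a \<in> \<Omega>" "x - a \<in> \<Omega>"
        using dist_triangle[of x0 "x + a" x] dist_triangle[of x0 "x - a" x] a sub\<Omega>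
        by (auto simp: dist_norm subset_iff)
      moreover have "x \<in> cball x0 r1" using x R by auto
      ultimately have "0 \<le> u x + gradient u x \<bullet> a - \<kappa> * R\<^sup>2" "0 \<le> u x - gradient u x \<bullet> a - \<kappa> * R\<^sup>2"
        using strong[of x "x + a"] strong[of x "x - a"] u0[of "x + a"] u0[of "x - a"] by (auto simp: a)
      then show ?thesis by linarith
    qed
    \<comment> \<open>Hypothesis (b) enters here; compactness has turned it into the uniform gap
      \<open>M - u s\<close>.\<close>
    have "u s < M" using s subU assms(9) by blast
    moreover have "\<kappa> * R\<^sup>2 > 0" using \<kappa> R by simp
    ultimately show ?thesis
    proof (intro that[of "min (\<kappa> * R\<^sup>2) (M - u s)"])
      fix x assume x: "x \<in> cball x0 R"
      show "min (\<kappa> * R\<^sup>2) (M - u s) \<le> u x" using low[OF x] by linarith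
      show "u x \<le> M - min (\<kappa> * R\<^sup>2) (M - u s)" using s(2)[OF x] by linarith
    qed simp
  qed

  obtain D where D: "D > 0" "\<And>x. x \<in> \<Omega> \<Longrightarrow> dist x0 x \<le> D"
  proof -
    obtain a where "\<And>x. x \<in> \<Omega> \<Longrightarrow> dist x0 x \<le> a"
      using bdd unfolding bounded_any_center[of _ x0] by blast
    then show ?thesis by (intro that[of "max a 1"]) (auto simp: le_max_iff_disj)
  qed

  \<comment> \<open>The wave vector\<close>
  let ?I = "\<lambda>f. LINT x|lebesgue. indicator (cball x0 R) x * f x"
  have int: "integrable lebesgue (\<lambda>x. indicator (cball x0 R) x * f x)"
    if "continuous_on UNIV f" for f :: "real ^ 2 \<Rightarrow> real"
    using that by (intro integrable_indicator_compact) (auto intro: continuous_on_subset)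
  define I where "I = ?I (\<lambda>x. (bump x0 R x)\<^sup>2)"
  define J where "J = ?I (\<lambda>x. Q (bump_grad x0 R x))"
  have I: "I > 0" unfolding I_def by (rule integral_bump_square_pos[OF R(1)])
  \<comment> \<open>Solves \<open>N\<^sup>2 * Q v * I = - \<bar>J\<bar> + Q v * I\<close>:
    oscillation along \<open>v\<close> then outweighs the contribution \<open>J\<close> of the bump
    gradient, which does not depend on the frequency.\<close>
  define N where "N = sqrt (\<bar>J\<bar> / (- Q v * I) + 1)"
  have "N\<^sup>2 = \<bar>J\<bar> / (- Q v * I) + 1"
    unfolding N_def using I Qv
    by (intro real_sqrt_pow2 add_nonneg_nonneg divide_nonneg_nonneg) (auto simp: mult_nonpos_nonneg)
  then have "N\<^sup>2 * Q v * I = - \<bar>J\<bar> + Q v * I" using I Qv by (simp add: field_simps)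
  moreover have "Q v * I < 0" using I Qv by (simp add: mult_neg_pos)
  ultimately have neg: "N\<^sup>2 * Q v * I + J < 0" by linarith
  define k where "k = N *\<^sub>R v"
  define Z where "Z x = (bump x0 R x)\<^sup>2 * Q k + Q (bump_grad x0 R x)" for x
  have cont_Qb: "continuous_on UNIV (\<lambda>x. Q (bump_grad x0 R x))"
    by (rule continuous_on_compose2[OF cont_Q continuous_on_bump_grad]) auto
  have cont_bump2: "continuous_on UNIV (\<lambda>x. (bump x0 R x)\<^sup>2)"
    by (intro continuous_intros continuous_on_bump)
  have contZ: "continuous_on UNIV Z"
    unfolding Z_def by (intro continuous_intros continuous_on_bump cont_Qb)
  have "?I Z = ?I (\<lambda>x. (bump x0 R x)\<^sup>2) * Q k + J"
    unfolding J_def Z_def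
    using int[OF cont_bump2] int[OF cont_Qb] by (simp add: distrib_left flip: mult.assoc)
  then have Zneg: "?I Z < 0"
    using neg by (simp add: I_def k_def Q_scale mult_ac)

  \<comment> \<open>The amplitude\<close>
  define C where "C = 16 * D\<^sup>2 + 2 * R\<^sup>2 + 4 * R\<^sup>2 * D * norm k + (R\<^sup>2)\<^sup>2 * (norm k)\<^sup>2"
  \<comment> \<open>In order: the wave's remainder is dominated by the strong concavity of
    \<open>u\<close>; the perturbation respects the margin \<open>m\<close> and the height allowed
    by \<open>concave_perturbation\<close> for the radii \<open>R\<close> and \<open>2 * R\<close>;
    gradients move by at most \<open>d / 4\<close>, so that the Hessian comparison for
    \<open>g\<close> applies.\<close>
  obtain t where t: "t > 0" "t * C \<le> \<kappa>" "t * (R\<^sup>2)\<^sup>2 \<le> min m (\<kappa> * R\<^sup>2)"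
    "t * (4 * R\<^sup>2 * R + (R\<^sup>2)\<^sup>2 * norm k) \<le> d / 4"
  proof -
    have "0 \<le> C" "0 \<le> 4 * R\<^sup>2 * R + (R\<^sup>2)\<^sup>2 * norm k"
      using R(1) D(1) by (auto simp: C_def)
    moreover have "0 < min m (\<kappa> * R\<^sup>2)" "0 < d / 4"
      using m(1) \<kappa> R(1) d(1) by auto
    ultimately show ?thesis
      using small_scale_exists[OF _ zero_le_power2 _ \<kappa>] that by blast
  qed

  \<comment> \<open>Comparison with the four phases\<close>
  define F where "F \<theta> x = g (gradient u x + t *\<^sub>R wave_grad x0 R k \<theta> x) - g (gradient u x)" for \<theta> x
  \<comment> \<open>For each phase, \<open>u\<close> plus the scaled wave is a competitor, so
    minimality makes the energy increment nonnegative.\<close>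
  have F: "integrable lebesgue (\<lambda>x. indicator (cball x0 R) x * F \<theta> x) \<and> 0 \<le> ?I (F \<theta>)" for \<theta>
  proof -
    define w where "w x = t * wave x0 R k \<theta> x" for x
    have abs_w: "\<bar>w x\<bar> \<le> min m (\<kappa> * R\<^sup>2)" for x
    proof -
      have "\<bar>w x\<bar> \<le> t * (R\<^sup>2)\<^sup>2"
        unfolding w_def abs_mult using t(1) by (intro mult_mono abs_wave_le) auto
      then show ?thesis using t(3) by linarith
    qed
    have w_supp: "w x = 0" if "x \<notin> cball x0 R" for x
      using wave_eq_0[OF that R(1)] by (simp add: w_def)
    have w_der: "(w has_derivative (\<lambda>h. (t *\<^sub>R wave_grad x0 R k \<theta> x) \<bullet> h)) (at x)" for x
      using has_derivative_mult_right[OF wave_has_derivative, of t] by (simp add: w_def[abs_def])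
    have cont: "continuous_on UNIV (\<lambda>x. t *\<^sub>R wave_grad x0 R k \<theta> x)"
      by (intro continuous_intros continuous_on_wave_grad)
    note E = energy_perturbation[OF fin assms(6,7) u1 cont_g subU w_der cont w_supp]
    have "concave_on \<Omega> (\<lambda>x. u x + w x)"
    proof (rule concave_perturbation[OF conc R(1) _ \<kappa>])
      show "R < 2 * R" using R by simp
      fix z y assume z: "z \<in> cball x0 (2 * R)" and y: "y \<in> \<Omega>"
      show "u y \<le> u z + gradient u z \<bullet> (y - z) - \<kappa> * (norm (y - z))\<^sup>2"
        using strong z y sub2 by blast
      have "wave x0 R k \<theta> y - wave x0 R k \<theta> z - wave_grad x0 R k \<theta> z \<bullet> (y - z) \<le> C * (norm (y - z))\<^sup>2"
        using wave_taylor_bound[OF D(2)[OF y] D(2)[OF subsetD[OF sub\<Omega> z]], of R k \<theta>]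
        unfolding C_def by (rule abs_le_D1)
      then have "t * (wave x0 R k \<theta> y - wave x0 R k \<theta> z - wave_grad x0 R k \<theta> z \<bullet> (y - z)) \<le> t * (C * (norm (y - z))\<^sup>2)"
        using t(1) by (intro mult_left_mono) auto
      also have "\<dots> \<le> \<kappa> * (norm (y - z))\<^sup>2"
        using mult_right_mono[OF t(2), of "(norm (y - z))\<^sup>2"] by (simp add: mult.assoc)
      finally show "w y \<le> w z + (t *\<^sub>R wave_grad x0 R k \<theta> z) \<bullet> (y - z) + \<kappa> * (norm (y - z))\<^sup>2"
        by (simp add: w_def algebra_simps)
    next
      show "w y \<le> \<kappa> * (2 * R - R)\<^sup>2" for y
        using abs_w[of y] by (auto simp: abs_le_iff)
    qed (rule w_supp)
    moreover have "0 \<le> u x + w x \<and> u x + w x \<le> M" if "x \<in> \<Omega>" for x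
    proof (cases "x \<in> cball x0 R")
      case True
      then show ?thesis using m(2,3)[OF True] abs_w[of x] by (simp add: abs_le_iff)
    next
      case False
      then show ?thesis using w_supp[OF False] u0 uM that by simp
    qed
    ultimately have "energy \<Omega> g u \<le> energy \<Omega> g (\<lambda>x. u x + w x)"
      by (intro opt E(1)) (auto simp: admissible_def)
    then show ?thesis using E(2,3) by (simp add: F_def)
  qed

  \<comment> \<open>The shift by \<open>pi\<close> replaces \<open>q\<close> by \<open>- q\<close>,
    so the sum is a second difference of \<open>g\<close>. Its points lie in
    \<open>ball p0 d\<close> since \<open>d / 2 + d / 4 < d\<close>.\<close>
  have pair: "F \<theta> x + F (\<theta> + pi) x \<le> t\<^sup>2 * Q (wave_grad x0 R k \<theta> x)" if x: "x \<in> cball x0 R" for \<theta> x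
  proof -
    define q where "q = t *\<^sub>R wave_grad x0 R k \<theta> x"
    have "norm q \<le> t * (4 * R\<^sup>2 * R + (R\<^sup>2)\<^sup>2 * norm k)"
      unfolding q_def norm_scaleR using t(1) x by (intro mult_mono norm_wave_grad_le) auto
    then have q: "norm q \<le> d / 4" using t(4) by linarith
    have gd: "dist p0 (gradient u x) < d / 2"
      using r2(2)[of x] x R by (simp add: dist_commute)
    have "(g (gradient u x + q) - g (gradient u x)) + (g (gradient u x - q) - g (gradient u x)) \<le> Q q"
      unfolding Q_def
    proof (rule C2_on_second_difference_le[OF C2_on_subset[OF assms(3)] d(2)])
      show "gradient u x \<in> ball p0 d" "gradient u x + q \<in> ball p0 d" "gradient u x - q \<in> ball p0 d"
        using gd q d(1) dist_triangle[of p0 "gradient u x + q" "gradient u x"]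
          dist_triangle[of p0 "gradient u x - q" "gradient u x"] by (auto simp: dist_norm)
    qed auto
    then show ?thesis
      by (simp add: F_def wave_grad_add_pi q_def Q_scale)
  qed
  \<comment> \<open>The four increments are nonnegative, yet by
    \<open>wave_grad_quadratic_sum\<close> their sum is at most \<open>t\<^sup>2 * ?I Z\<close>,
    which is negative.\<close>
  have "0 \<le> ?I (F 0) + ?I (F (0 + pi)) + (?I (F (pi / 2)) + ?I (F (pi / 2 + pi)))"
    using F by (intro add_nonneg_nonneg) auto
  also have "\<dots> = ?I (\<lambda>x. F 0 x + F (0 + pi) x + (F (pi / 2) x + F (pi / 2 + pi) x))"
    using F by (simp add: distrib_left)
  also have "\<dots> \<le> ?I (\<lambda>x. t\<^sup>2 * Z x)"
  proof (rule integral_mono)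
    show "integrable lebesgue (\<lambda>x. indicator (cball x0 R) x *
        (F 0 x + F (0 + pi) x + (F (pi / 2) x + F (pi / 2 + pi) x)))"
      unfolding distrib_left using F by (intro Bochner_Integration.integrable_add) auto
    show "integrable lebesgue (\<lambda>x. indicator (cball x0 R) x * (t\<^sup>2 * Z x))"
      by (intro int continuous_intros contZ)
    fix x
    have "F 0 x + F (0 + pi) x + (F (pi / 2) x + F (pi / 2 + pi) x) \<le> t\<^sup>2 * Z x"
      if x: "x \<in> cball x0 R"
      using add_mono[OF pair[OF x, of 0] pair[OF x, of "pi / 2"]]
      unfolding distrib_left[symmetric] Z_def
        wave_grad_quadratic_sum[of x0 R k x "hessian g p0" e, folded Q_def] .
    then show "indicator (cball x0 R) x * (F 0 x + F (0 + pi) x + (F (pi / 2) x + F (pi / 2 + pi) x))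
        \<le> indicator (cball x0 R) x * (t\<^sup>2 * Z x)"
      by (simp add: indicator_def)
  qed
  also have "\<dots> = t\<^sup>2 * ?I Z"
    by (subst integral_mult_right_zero[symmetric]) (simp only: mult.left_commute)
  also have "\<dots> < 0"
    using t(1) Zneg by (simp add: mult_pos_neg)
  finally show False by simp
qed

end
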